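(* Let $d,T\in\mathbb{N}$, $p>0$ (with $p=\infty$ allowed), $L>0$, and let $\eta_1,\dots,\eta_T>0$. Consider a noisy iterative algorithm in $\mathbb{R}^d$ with update rule $W_t=g(W_{t-1})-\eta_tF(W_{t-1},Z_t)+\xi_t$, $1\le t\le T$, as described in the context, where $\xi_t$ has probability density $f_t:\mathbb{R}^d\to\mathbb{R}$, and let $W$ be its final output (a function of $W^T=(W_1,\dots,W_T)$). Suppose that for every $t$ the density $f_t$ is maximized at $0$, i.e. $f_t(0)\ge f_t(x)$ for all $x\in\mathbb{R}^d$. Suppose that the sampling strategy is agnostic to the parameter vectors, i.e. $P(Z_{t+1}\mid Z^t,W^t,S)=P(Z_{t+1}\mid Z^t,S)$ for all $t$, and that $\sup_{w,z}\|F(w,z)\|_p\le L$. Then $$\mathcal{L}(S\to W)\ \le\ \sum_{t=1}^T\log\Big(f_t(0)\,V_p(d,\eta_tL)+h(d,p,f_t,\eta_tL)\Big),$$ where $V_p(d,r)$ is the volume of the ball $\mathcal{B}_p^d(0,r)=\{x\in\mathbb{R}^d:\|x\|_p\le r\}$ and $$h(d,p,f,r)=\int_{\mathbb{R}^d\setminus\mathcal{B}_p^d(0,r)}\ \sup_{x\in\mathcal{B}_p^d(0,r)}f(w-x)\,\mathrm{d}w .$$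
   Context: Maximal leakage: for random variables $X,Y$ with joint law $P_{XY}$, $\mathcal{L}(X\to Y)=I_\infty(X,Y)=\min_{Q_Y}D_\infty(P_{XY}\|P_XQ_Y)=\log\mathbb{E}_{P_Y}\big[\operatorname{ess\,sup}_{P_X}\frac{dP_{XY}}{d(P_XP_Y)}\big]$, where $D_\infty$ is the Rényi divergence of order $\infty$. If $X,Y$ are jointly continuous this equals $\log\int\operatorname{ess\,sup}_{P_X}f_{Y|X}(y|x)\,dy$. Logarithms are natural. Setup: $S=(Z'_1,\dots,Z'_n)$ is a data set of $n$ i.i.d. samples from an unknown distribution on a sample space $\mathcal{Z}$. The algorithm generates $W_t=g(W_{t-1})-\eta_tF(W_{t-1},Z_t)+\xi_t$ for $t=1,\dots,T$, where $Z_t\subseteq S$ is a (possibly random) subset (mini-batch) of the data sampled according to some distribution, $g:\mathbb{R}^d\to\mathbb{R}^d$ is a deterministic function, $F(w,z)\in\mathbb{R}^d$ is a direction (e.g. a gradient), $\eta_t$ is the step-size, and $\xi_t$ is an $\mathbb{R}^d$-valued noise with an absolutely continuous distribution. The initial point $W_0$ is independent of $(S,Z_1,\dots,Z_T)$, and the noises $\xi_1,\dots,\xi_T$ are mutually independent and independent of $(W_0,S,Z_1,\dots,Z_T)$; thus $P(W_{t+1}\mid W^t,Z^T,S)=P(W_{t+1}\mid W_t,Z_{t+1})$. Notation: $W^t=(W_1,\dots,W_t)$, $Z^t=(Z_1,\dots,Z_t)$. $\|x\|_p=(\sum_i|x_i|^p)^{1/p}$ for $0<p<\infty$ and $\|x\|_\infty=\max_i|x_i|$.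 *)

theory Defs
  imports "HOL-Probability.Probability" "HOL-Library.Multiset"
begin

text \<open>The natural logarithm \<open>[0, \<infinity>] \<rightarrow> [-\<infinity>, \<infinity>]\<close>; recall that the library's real \<^term>\<open>ln\<close>
  takes an unwanted value at \<open>0\<close>.\<close>

definition ln_ennreal :: "ennreal \<Rightarrow> ereal" where
  "ln_ennreal x = (if x = 0 then - \<infinity> else if x = \<infinity> then \<infinity> else ereal (ln (enn2real x)))"

text \<open>Renyi divergence \<open>D\<^sub>\<infinity>(P \<parallel> Q) = log ess sup\<^sub>P dP/dQ\<close> of two probability measures on the same
  \<open>\<sigma>\<close>-algebra, and \<open>\<infinity>\<close> if \<open>P\<close> is not absolutely continuous with respect to \<open>Q\<close>. In the library
  both \<^const>\<open>absolutely_continuous\<close> and \<^const>\<open>RN_deriv\<close> take the reference measure first.\<close>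

definition renyi_div_inf :: "'a measure \<Rightarrow> 'a measure \<Rightarrow> ereal" where
  "renyi_div_inf P Q =
     (if absolutely_continuous Q P then ln_ennreal (esssup P (RN_deriv Q P)) else \<infinity>)"

text \<open>\<open>\<L>(X \<rightarrow> Y) = I\<^sub>\<infinity>(X, Y) = min\<^sub>Q D\<^sub>\<infinity>(P\<^sub>X\<^sub>Y \<parallel> P\<^sub>X \<otimes> Q)\<close>, where \<open>Q\<close> ranges over the probability
  measures on the target space of \<open>Y\<close>.\<close>

definition maximal_leakage ::
  "'w measure \<Rightarrow> 'x measure \<Rightarrow> ('w \<Rightarrow> 'x) \<Rightarrow> 'y measure \<Rightarrow> ('w \<Rightarrow> 'y) \<Rightarrow> ereal" where
  "maximal_leakage M MX X MY Y =
     (INF Q \<in> {Q. prob_space Q \<and> sets Q = sets MY}.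
        renyi_div_inf (distr M (MX \<Otimes>\<^sub>M MY) (\<lambda>\<omega>. (X \<omega>, Y \<omega>))) (distr M MX X \<Otimes>\<^sub>M Q))"

definition tuple :: "'i set \<Rightarrow> ('i \<Rightarrow> 'w \<Rightarrow> 'a) \<Rightarrow> 'w \<Rightarrow> 'i \<Rightarrow> 'a" where
  "tuple I X \<omega> = (\<lambda>i\<in>I. X i \<omega>)"

text \<open>Independence of two random variables with values in spaces of different types; the
  library's \<open>indep_var\<close> forces both to have the same type of values.\<close>

definition indep_rv ::
  "'w measure \<Rightarrow> 'x measure \<Rightarrow> ('w \<Rightarrow> 'x) \<Rightarrow> 'y measure \<Rightarrow> ('w \<Rightarrow> 'y) \<Rightarrow> bool" where
  "indep_rv M MX X MY Y \<longleftrightarrow>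
     prob_space.indep_set M (sets (vimage_algebra (space M) X MX))
                            (sets (vimage_algebra (space M) Y MY))"

definition cond_prob_given ::
  "'w measure \<Rightarrow> 'y measure \<Rightarrow> ('w \<Rightarrow> 'y) \<Rightarrow> 'w set \<Rightarrow> 'w \<Rightarrow> real" where
  "cond_prob_given M MY Y A =
     real_cond_exp M (vimage_algebra (space M) Y MY) (indicator A)"

text \<open>\<open>P(X | U) = P(X | V)\<close>: for every measurable set \<open>A\<close> of values of \<open>X\<close>, the conditional
  probabilities of \<open>X \<in> A\<close> given \<open>U\<close> and given \<open>V\<close> agree almost surely.\<close>

definition same_cond_law ::
  "'w measure \<Rightarrow> 'x measure \<Rightarrow> ('w \<Rightarrow> 'x) \<Rightarrow> 'u measure \<Rightarrow> ('w \<Rightarrow> 'u) \<Rightarrow>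
   'v measure \<Rightarrow> ('w \<Rightarrow> 'v) \<Rightarrow> bool" where
  "same_cond_law M MX X MU U MV V \<longleftrightarrow>
     (\<forall>A\<in>sets MX. AE \<omega> in M.
        cond_prob_given M MU U (X -` A \<inter> space M) \<omega> = cond_prob_given M MV V (X -` A \<inter> space M) \<omega>)"

text \<open>The exponent ranges over \<open>(0, \<infinity>]\<close>; for \<open>p < 1\<close> this is only a quasi-norm.\<close>

definition lp_norm :: "ennreal \<Rightarrow> real ^ 'd \<Rightarrow> real" where
  "lp_norm p x =
     (if p = \<infinity> then (MAX i. \<bar>x $ i\<bar>)
      else (\<Sum>i\<in>UNIV. \<bar>x $ i\<bar> powr enn2real p) powr (1 / enn2real p))"

definition lp_ball :: "ennreal \<Rightarrow> real \<Rightarrow> (real ^ 'd) set" where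
  "lp_ball p r = {x. lp_norm p x \<le> r}"

definition lp_ball_vol :: "'d::finite itself \<Rightarrow> ennreal \<Rightarrow> real \<Rightarrow> ennreal" where
  "lp_ball_vol _ p r = emeasure lebesgue (lp_ball p r :: (real ^ 'd) set)"

text \<open>The supremum of a Borel function over an uncountable family of translates need not be
  Borel, but it is Lebesgue measurable (its superlevel sets are sums of a Borel set and a ball,
  hence analytic); therefore the integral is taken with respect to \<^const>\<open>lebesgue\<close>, not
  \<^const>\<open>lborel\<close>.\<close>

definition h_tail :: "ennreal \<Rightarrow> (real ^ 'd \<Rightarrow> real) \<Rightarrow> real \<Rightarrow> ennreal" where
  "h_tail p f r =
     (\<integral>\<^sup>+ w \<in> - lp_ball p r. (SUP x\<in>lp_ball p r. ennreal (f (w - x))) \<partial>lebesgue)"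

end

theory Submission
  imports Defs
begin

text \<open>Write \<open>Y\<close> for the data set together with all mini-batches, and \<open>c\<^sub>t\<close> for the argument of the
  \<open>t\<close>-th logarithm. Conditionally on \<open>Y = y\<close> and \<open>W\<^sub>t\<^sub>-\<^sub>1 = u\<close>, the iterate \<open>W\<^sub>t\<close> has density
  \<open>f\<^sub>t (v - g u + \<eta>\<^sub>t F u z\<^sub>t)\<close>. Its essential supremum over \<open>y\<close> is a jointly measurable kernel
  \<open>k\<^sub>t(u, v)\<close> that no longer depends on \<open>y\<close>; it is at most the supremum of \<open>f\<^sub>t\<close> over the translates
  \<open>v - g u - x\<close> with \<open>x\<close> in the ball of radius \<open>\<eta>\<^sub>t L\<close>, so it has mass at most \<open>c\<^sub>t\<close> (bound \<open>f\<^sub>t\<close> by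
  \<open>f\<^sub>t 0\<close> when \<open>v - g u\<close> lies in that ball). By induction on \<open>t\<close>, the joint law of \<open>Y\<close> and
  \<open>(W\<^sub>0, \<dots>, W\<^sub>t)\<close> is dominated by the product of the law of \<open>Y\<close> with a measure of mass at most
  \<open>c\<^sub>1 \<cdots> c\<^sub>t\<close>. Normalising this measure and pushing it forward to the output gives a
  candidate \<open>Q\<close> in the definition of the leakage.\<close>

section \<open>The extended logarithm and a criterion for bounding the Renyi divergence\<close>

lemma ln_ennreal_mono: "x \<le> y \<Longrightarrow> ln_ennreal x \<le> ln_ennreal y"
  by (cases x; cases y) (auto simp: ln_ennreal_def top_unique ln_le_cancel_iff)

text \<open>Factors in \<open>[1, \<infinity>)\<close> stay where \<open>ln_ennreal\<close> is the
  real logarithm of a positive number, so no infinite terms of opposite sign can meet in the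
  sum.\<close>

lemma ln_ennreal_prod:
  assumes "finite I" "\<And>i. i \<in> I \<Longrightarrow> 1 \<le> c i" "\<And>i. i \<in> I \<Longrightarrow> c i \<noteq> \<infinity>"
  shows "ln_ennreal (\<Prod>i\<in>I. c i) = (\<Sum>i\<in>I. ln_ennreal (c i))"
proof -
  have c: "c i = ennreal (enn2real (c i))" "1 \<le> enn2real (c i)" if "i \<in> I" for i
    using assms(2,3)[OF that] by (cases "c i"; auto simp flip: ennreal_1)+
  have pos: "0 < (\<Prod>i\<in>I. enn2real (c i))"
    using c by (intro prod_pos) force
  have "(\<Prod>i\<in>I. c i) = ennreal (\<Prod>i\<in>I. enn2real (c i))"
    using c by (subst prod_ennreal[symmetric]) (auto intro: prod.cong)
  then have "ln_ennreal (\<Prod>i\<in>I. c i) = ereal (ln (\<Prod>i\<in>I. enn2real (c i)))"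
    using pos by (simp add: ln_ennreal_def)
  also have "\<dots> = (\<Sum>i\<in>I. ereal (ln (enn2real (c i))))"
    using c by (subst ln_prod) (force simp: assms(1))+
  also have "\<dots> = (\<Sum>i\<in>I. ln_ennreal (c i))"
    using assms(2,3) by (intro sum.cong) (force simp: ln_ennreal_def)+
  finally show ?thesis .
qed

text \<open>The setwise bound makes null sets of \<open>R\<close> null for \<open>P\<close>, so a
  density of \<open>P\<close> exists. On the set \<open>E\<close> where this density exceeds
  \<open>C\<close>, integrating it would give more than \<open>C * emeasure R E\<close> unless
  \<open>E\<close> is null; hence the density is at most \<open>C\<close> almost everywhere.\<close>

lemma renyi_div_inf_le:
  assumes "prob_space R" and sets: "sets P = sets R"
    and C: "C \<noteq> \<infinity>" and le: "\<And>A. A \<in> sets R \<Longrightarrow> emeasure P A \<le> C * emeasure R A"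
  shows "renyi_div_inf P R \<le> ln_ennreal C"
proof -
  interpret R: prob_space R by fact
  let ?D = "RN_deriv R P"
  have ac: "absolutely_continuous R P"
    unfolding absolutely_continuous_def
  proof
    fix A assume "A \<in> null_sets R"
    then show "A \<in> null_sets P"
      using le[of A] by (intro null_setsI) (auto simp: null_sets_def sets)
  qed
  have P: "density R ?D = P"
    by (rule R.density_RN_deriv) (auto simp: ac sets)
  define E where "E = {x \<in> space R. C < ?D x}"
  have E[measurable]: "E \<in> sets R" unfolding E_def by measurable
  have int: "(\<integral>\<^sup>+x. C * indicator E x \<partial>R) = C * emeasure R E"
    by (simp add: nn_integral_cmult_indicator)
  have "AE x in R. ?D x * indicator E x \<le> C * indicator E x"
  proof (rule ccontr)
    assume *: "\<not> ?thesis"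
    have "(\<integral>\<^sup>+x. C * indicator E x \<partial>R) < (\<integral>\<^sup>+x. ?D x * indicator E x \<partial>R)"
    \<comment> \<open>Strict inequality between the integrals requires the smaller one to be finite;
      this is where \<open>C \<noteq> \<infinity>\<close> enters.\<close>
    proof (rule nn_integral_less)
      show "(\<integral>\<^sup>+x. C * indicator E x \<partial>R) \<noteq> \<infinity>"
        unfolding int using C by (simp add: ennreal_mult_eq_top_iff)
      show "AE x in R. C * indicator E x \<le> ?D x * indicator E x"
        by (auto simp: E_def split: split_indicator)
    qed (use * in simp_all)
    also have "\<dots> = emeasure P E"
      by (subst (2) P[symmetric]) (simp add: emeasure_density)
    finally show False
      using le[OF E] by (simp add: int)
  qed
  then have "AE x in R. ?D x \<le> C"
    by (rule AE_mp) (auto simp: E_def not_less[symmetric] split: split_indicator)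
  \<comment> \<open>\<open>renyi_div_inf\<close> takes the essential supremum with respect to
    \<open>P\<close>, so the bound is carried from \<open>R\<close> to \<open>P\<close>, seen as a
    density over \<open>R\<close>.\<close>
  then have "AE x in P. ?D x \<le> C"
    by (subst P[symmetric]) (auto simp: AE_density elim: eventually_mono)
  moreover have "?D \<in> borel_measurable P"
    using measurable_cong_sets[OF sets refl, of borel] borel_measurable_RN_deriv[of R P] by blast
  ultimately have "esssup P ?D \<le> C" by (rule esssup_I[rotated])
  then show ?thesis
    by (simp add: renyi_div_inf_def ac ln_ennreal_mono)
qed

section \<open>Essential suprema of kernels and the domination of a transition\<close>

text \<open>The essential supremum is at most \<open>a\<close> exactly when the section at
  \<open>r\<close> of the superlevel set \<open>{q > a}\<close> is a null set, and the measure of a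
  section depends measurably on \<open>r\<close>.\<close>

lemma borel_measurable_esssup:
  fixes q :: "'r \<Rightarrow> 'y \<Rightarrow> ennreal"
  assumes "sigma_finite_measure \<nu>" and q: "case_prod q \<in> borel_measurable (R \<Otimes>\<^sub>M \<nu>)"
  shows "(\<lambda>r. esssup \<nu> (q r)) \<in> borel_measurable R"
proof (rule borel_measurableI_le)
  interpret sigma_finite_measure \<nu> by fact
  fix a :: ennreal
  let ?S = "{x \<in> space (R \<Otimes>\<^sub>M \<nu>). a < case_prod q x}"
  have S: "?S \<in> sets (R \<Otimes>\<^sub>M \<nu>)" using q by measurable
  have "esssup \<nu> (q r) \<le> a \<longleftrightarrow> emeasure \<nu> (Pair r -` ?S) = 0" if r: "r \<in> space R" for r
  proof -
    have m[measurable]: "q r \<in> borel_measurable \<nu>"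
      using measurable_Pair2[OF q r] by simp
    have eq: "Pair r -` ?S = {y \<in> space \<nu>. a < q r y}"
      using r by (auto simp: space_pair_measure)
    have "emeasure \<nu> {y \<in> space \<nu>. a < q r y} = 0 \<longleftrightarrow> (AE y in \<nu>. q r y \<le> a)"
      by (subst AE_iff_measurable[OF _ refl]) (auto simp: not_le)
    \<comment> \<open>\<open>esssup\<close> is the top element for a function that is not
      measurable, so it is the step from the pointwise bound to the essential supremum that calls
      for the measurability \<open>m\<close>.\<close>
    moreover have "esssup \<nu> (q r) \<le> a \<longleftrightarrow> (AE y in \<nu>. q r y \<le> a)"
      using esssup_AE[where M=\<nu> and f="q r"] esssup_I[OF m] by (auto elim: eventually_mono)
    ultimately show ?thesis unfolding eq by blast
  qed
  then have "{r \<in> space R. esssup \<nu> (q r) \<le> a}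
      = {r \<in> space R. emeasure \<nu> (Pair r -` ?S) = 0}" by auto
  then show "{r \<in> space R. esssup \<nu> (q r) \<le> a} \<in> sets R"
    using measurable_emeasure_Pair[OF S] by simp
qed

lemma nn_integral_lborel_shift:
  fixes h :: "'a::euclidean_space \<Rightarrow> ennreal"
  assumes [measurable]: "h \<in> borel_measurable borel"
  shows "(\<integral>\<^sup>+x. h (c + x) \<partial>lborel) = (\<integral>\<^sup>+x. h x \<partial>lborel)"
proof -
  have "(\<integral>\<^sup>+x. h x \<partial>lborel) = (\<integral>\<^sup>+x. h x \<partial>distr lborel borel ((+) c))"
    by (simp add: lborel_distr_plus)
  also have "\<dots> = (\<integral>\<^sup>+x. h (c + x) \<partial>lborel)"
    by (simp add: nn_integral_distr)
  finally show ?thesis ..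
qed

text \<open>The conditional densities \<open>q y\<close> are replaced by their essential supremum over \<open>y\<close>, which
  unlike the pointwise supremum is always jointly measurable.\<close>

lemma nn_integral_transition_le:
  fixes q :: "'y \<Rightarrow> 'h \<times> 'v \<Rightarrow> ennreal"
  assumes "sigma_finite_measure \<nu>" "sigma_finite_measure Q" "sigma_finite_measure l"
    and sets: "sets P = sets (\<nu> \<Otimes>\<^sub>M Q)" and le: "P \<le> \<nu> \<Otimes>\<^sub>M Q"
    and q[measurable]: "case_prod q \<in> borel_measurable (\<nu> \<Otimes>\<^sub>M (Q \<Otimes>\<^sub>M l))"
    and G[measurable]: "case_prod G \<in> borel_measurable (\<nu> \<Otimes>\<^sub>M (Q \<Otimes>\<^sub>M l))"
    and K: "K = (\<lambda>r. esssup \<nu> (\<lambda>y. q y r))"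
    and sf: "sigma_finite_measure (density (Q \<Otimes>\<^sub>M l) K)"
  shows "(\<integral>\<^sup>+(y, h). (\<integral>\<^sup>+v. G y (h, v) * q y (h, v) \<partial>l) \<partial>P)
    \<le> (\<integral>\<^sup>+(y, r). G y r \<partial>(\<nu> \<Otimes>\<^sub>M density (Q \<Otimes>\<^sub>M l) K))"
proof -
  interpret \<nu>: sigma_finite_measure \<nu> by fact
  interpret Q: sigma_finite_measure Q by fact
  interpret l: sigma_finite_measure l by fact
  interpret Ql: pair_sigma_finite Q l ..
  interpret \<nu>R: pair_sigma_finite \<nu> "Q \<Otimes>\<^sub>M l" ..
  interpret D: sigma_finite_measure "density (Q \<Otimes>\<^sub>M l) K" by fact
  have q': "(\<lambda>(r, y). q y r) \<in> borel_measurable ((Q \<Otimes>\<^sub>M l) \<Otimes>\<^sub>M \<nu>)" by measurable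
  have Km[measurable]: "K \<in> borel_measurable (Q \<Otimes>\<^sub>M l)"
    unfolding K by (rule borel_measurable_esssup[OF \<open>sigma_finite_measure \<nu>\<close> q'])
  have "(\<integral>\<^sup>+(y, h). (\<integral>\<^sup>+v. G y (h, v) * q y (h, v) \<partial>l) \<partial>P)
      \<le> (\<integral>\<^sup>+(y, h). (\<integral>\<^sup>+v. G y (h, v) * q y (h, v) \<partial>l) \<partial>(\<nu> \<Otimes>\<^sub>M Q))"
    by (rule nn_integral_mono_measure[OF sets le])
  also have "\<dots> = (\<integral>\<^sup>+y. \<integral>\<^sup>+h. \<integral>\<^sup>+v. G y (h, v) * q y (h, v) \<partial>l \<partial>Q \<partial>\<nu>)"
    by (subst Q.nn_integral_fst[symmetric]) auto
  also have "\<dots> = (\<integral>\<^sup>+y. \<integral>\<^sup>+r. G y r * q y r \<partial>(Q \<Otimes>\<^sub>M l) \<partial>\<nu>)"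
    by (intro nn_integral_cong) (simp add: l.nn_integral_fst[symmetric])
  also have "\<dots> = (\<integral>\<^sup>+r. \<integral>\<^sup>+y. G y r * q y r \<partial>\<nu> \<partial>(Q \<Otimes>\<^sub>M l))"
    by (rule \<nu>R.Fubini'[symmetric]) measurable
  also have "\<dots> \<le> (\<integral>\<^sup>+r. \<integral>\<^sup>+y. G y r * K r \<partial>\<nu> \<partial>(Q \<Otimes>\<^sub>M l))"
  \<comment> \<open>Fubini has made \<open>y\<close> the inner variable: for each fixed
    \<open>r\<close> the bound \<open>q y r \<le> K r\<close> holds for almost every
    \<open>y\<close>, and the exceptional null set may depend on \<open>r\<close>.\<close>
  proof (rule nn_integral_mono, rule nn_integral_mono_AE)
    fix r
    show "AE y in \<nu>. G y r * q y r \<le> G y r * K r"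
      using esssup_AE[where M=\<nu> and f="\<lambda>y. q y r"]
      by (rule eventually_mono) (auto simp: K intro: mult_left_mono)
  qed
  also have "\<dots> = (\<integral>\<^sup>+y. \<integral>\<^sup>+r. G y r * K r \<partial>(Q \<Otimes>\<^sub>M l) \<partial>\<nu>)"
    by (rule \<nu>R.Fubini') measurable
  also have "\<dots> = (\<integral>\<^sup>+y. \<integral>\<^sup>+r. G y r \<partial>density (Q \<Otimes>\<^sub>M l) K \<partial>\<nu>)"
    by (intro nn_integral_cong) (simp add: nn_integral_density mult.commute)
  also have "\<dots> = (\<integral>\<^sup>+(y, r). G y r \<partial>(\<nu> \<Otimes>\<^sub>M density (Q \<Otimes>\<^sub>M l) K))"
    by (subst D.nn_integral_fst[symmetric]) auto
  finally show ?thesis .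
qed

section \<open>Balls of the \<open>p\<close>-(quasi-)norm and the tail integral\<close>

text \<open>Homogeneity turns the bound \<open>L\<close> on the direction into the radius
  \<open>\<eta> t * L\<close>; it holds for the quasi-norms with \<open>p < 1\<close> as
  well.\<close>

lemma lp_norm_scaleR: "lp_norm p (c *\<^sub>R x) = \<bar>c\<bar> * lp_norm p x" if "p > 0"
proof (cases "p = \<infinity>")
  case True
  have "(MAX i. \<bar>c\<bar> * \<bar>x $ i\<bar>) = \<bar>c\<bar> * (MAX i. \<bar>x $ i\<bar>)"
    using mono_Max_commute[of "(*) \<bar>c\<bar>" "range (\<lambda>i. \<bar>x $ i\<bar>)"]
    by (simp add: mono_def mult_left_mono image_image)
  then show ?thesis using True by (simp add: lp_norm_def abs_mult)
next
  case False
  then have "enn2real p > 0" using that by (cases p) auto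
  moreover have "(\<Sum>i\<in>UNIV. \<bar>(c *\<^sub>R x) $ i\<bar> powr enn2real p)
      = \<bar>c\<bar> powr enn2real p * (\<Sum>i\<in>UNIV. \<bar>x $ i\<bar> powr enn2real p)"
    by (simp add: abs_mult powr_mult sum_distrib_left)
  ultimately show ?thesis using False
    by (simp add: lp_norm_def powr_mult sum_nonneg powr_powr)
qed

lemma lp_ball_uminus: "- x \<in> lp_ball p r \<longleftrightarrow> x \<in> lp_ball p r"
  by (simp add: lp_ball_def lp_norm_def)

lemma zero_in_lp_ball: "0 \<le> r \<Longrightarrow> 0 \<in> lp_ball p r"
  by (simp add: lp_ball_def lp_norm_def image_constant_conv)

lemma lp_ball_borel[measurable]: "lp_ball p r \<in> sets borel"
proof (cases "p = \<infinity>")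
  case True
  have "lp_ball p r = {x. \<forall>i. \<bar>x $ i\<bar> \<le> r}"
    using True by (auto simp: lp_ball_def lp_norm_def)
  also have "\<dots> \<in> sets borel" by measurable
  finally show ?thesis .
next
  case False
  then show ?thesis unfolding lp_ball_def lp_norm_def by simp
qed

text \<open>On the ball the supremum is at most \<open>f 0\<close>; off the ball it is the integrand
  of \<open>h_tail\<close>. The Borel function \<open>k\<close> stands below the supremum so that
  its integral splits additively over the two regions. It is applied to the density itself and to
  the essential supremum over the data.\<close>

lemma nn_integral_le_ball_plus_h_tail:
  fixes f :: "real ^ 'd \<Rightarrow> real"
  assumes max: "\<And>x. f x \<le> f 0"
    and k[measurable]: "k \<in> borel_measurable borel"
    and le: "\<And>w. k w \<le> (SUP x\<in>lp_ball p r. ennreal (f (w - x)))"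
  shows "(\<integral>\<^sup>+w. k w \<partial>lborel) \<le> ennreal (f 0) * lp_ball_vol TYPE('d) p r + h_tail p f r"
proof -
  let ?B = "lp_ball p r :: (real ^ 'd) set"
  have "k w \<le> ennreal (f 0)" for w
    using le[of w] by (rule order_trans) (auto intro!: SUP_least ennreal_leI max)
  then have "(\<integral>\<^sup>+w. k w * indicator ?B w \<partial>lborel) \<le> (\<integral>\<^sup>+w. ennreal (f 0) * indicator ?B w \<partial>lborel)"
    by (intro nn_integral_mono) (auto intro: mult_right_mono)
  also have "\<dots> = ennreal (f 0) * lp_ball_vol TYPE('d) p r"
    by (simp add: nn_integral_cmult_indicator lp_ball_vol_def)
  finally have 1: "(\<integral>\<^sup>+w. k w * indicator ?B w \<partial>lborel) \<le> ennreal (f 0) * lp_ball_vol TYPE('d) p r" .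
  have 2: "(\<integral>\<^sup>+w. k w * indicator (- ?B) w \<partial>lborel) \<le> h_tail p f r"
    \<comment> \<open>The nonnegative integral is a supremum over simple functions below the
      integrand. It therefore has the same value for \<open>lebesgue\<close> and
      \<open>lborel\<close> whatever the integrand, and monotonicity applies to the possibly
      non-Borel supremum.\<close>
    unfolding h_tail_def nn_integral_completion
    by (intro nn_integral_mono mult_right_mono le) auto
  have "(\<integral>\<^sup>+w. k w \<partial>lborel)
      = (\<integral>\<^sup>+w. k w * indicator ?B w + k w * indicator (- ?B) w \<partial>lborel)"
    by (intro nn_integral_cong) (auto split: split_indicator)
  also have "\<dots> = (\<integral>\<^sup>+w. k w * indicator ?B w \<partial>lborel) + (\<integral>\<^sup>+w. k w * indicator (- ?B) w \<partial>lborel)"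
    by (rule nn_integral_add) auto
  finally show ?thesis using add_mono[OF 1 2] by simp
qed

section \<open>Independence of variables with values in different spaces\<close>

lemma indep_rv_iff:
  assumes "prob_space M" and X: "X \<in> M \<rightarrow>\<^sub>M MX" and Y: "Y \<in> M \<rightarrow>\<^sub>M MY"
  shows "indep_rv M MX X MY Y \<longleftrightarrow>
    (\<forall>A\<in>sets MX. \<forall>B\<in>sets MY. measure M ((X -` A \<inter> space M) \<inter> (Y -` B \<inter> space M))
        = measure M (X -` A \<inter> space M) * measure M (Y -` B \<inter> space M))"
proof -
  interpret prob_space M by fact
  have sX: "sets (vimage_algebra (space M) X MX) = {X -` A \<inter> space M |A. A \<in> sets MX}"
    using measurable_space[OF X] by (intro sets_vimage_algebra2) auto
  have sY: "sets (vimage_algebra (space M) Y MY) = {Y -` A \<inter> space M |A. A \<in> sets MY}"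
    using measurable_space[OF Y] by (intro sets_vimage_algebra2) auto
  show ?thesis
    unfolding indep_rv_def sX sY
  proof (intro iffI ballI)
    assume "indep_set {X -` A \<inter> space M |A. A \<in> sets MX} {Y -` A \<inter> space M |A. A \<in> sets MY}"
    then show "prob ((X -` A \<inter> space M) \<inter> (Y -` B \<inter> space M))
        = prob (X -` A \<inter> space M) * prob (Y -` B \<inter> space M)"
      if "A \<in> sets MX" "B \<in> sets MY" for A B
      using that by (intro indep_setD) auto
  qed (intro indep_setI, use measurable_sets[OF X] measurable_sets[OF Y] in auto)
qed

lemma indep_rv_commute:
  assumes "prob_space M" "X \<in> M \<rightarrow>\<^sub>M MX" "Y \<in> M \<rightarrow>\<^sub>M MY" "indep_rv M MX X MY Y"
  shows "indep_rv M MY Y MX X"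
  using assms by (auto simp: indep_rv_iff Int_commute mult.commute)

text \<open>Measurability of \<open>X'\<close> for the algebra generated by \<open>X\<close> puts
  all events of \<open>X'\<close> among those of \<open>X\<close>. This form avoids an explicit
  factorisation of \<open>X'\<close> through \<open>X\<close>, which suits recursively defined
  iterates.\<close>

lemma indep_rv_measurable_left:
  assumes "prob_space M" and X: "X \<in> M \<rightarrow>\<^sub>M MX" and Y: "Y \<in> M \<rightarrow>\<^sub>M MY"
    and ind: "indep_rv M MX X MY Y"
    and X': "X' \<in> vimage_algebra (space M) X MX \<rightarrow>\<^sub>M MX'"
  shows "indep_rv M MX' X' MY Y"
proof -
  interpret prob_space M by fact
  have *: "sets (vimage_algebra (space M) X' MX') \<subseteq> sets (vimage_algebra (space M) X MX)"
    using measurable_sets[OF X'] sets_vimage_algebra_space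
    by (intro sets_image_in_sets') (simp_all add: sets_vimage_algebra_space)
  note ind = ind[unfolded indep_rv_def]
  show ?thesis
    unfolding indep_rv_def
  proof (rule indep_setI)
    show "sets (vimage_algebra (space M) X' MX') \<subseteq> events"
      using * indep_setD_ev1[OF ind] by (rule order_trans)
    show "sets (vimage_algebra (space M) Y MY) \<subseteq> events"
      by (rule indep_setD_ev2[OF ind])
  qed (rule indep_setD[OF ind subsetD[OF *]])
qed

lemma distr_pair_indep_rv:
  assumes "prob_space M" and X[measurable]: "X \<in> M \<rightarrow>\<^sub>M MX" and Y[measurable]: "Y \<in> M \<rightarrow>\<^sub>M MY"
    and ind: "indep_rv M MX X MY Y"
  shows "distr M (MX \<Otimes>\<^sub>M MY) (\<lambda>\<omega>. (X \<omega>, Y \<omega>)) = distr M MX X \<Otimes>\<^sub>M distr M MY Y"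
proof (rule pair_measure_eqI[symmetric])
  interpret prob_space M by fact
  interpret DX: prob_space "distr M MX X" by (rule prob_space_distr) simp
  interpret DY: prob_space "distr M MY Y" by (rule prob_space_distr) simp
  show "sigma_finite_measure (distr M MX X)" "sigma_finite_measure (distr M MY Y)"
    by unfold_locales
  fix A B assume "A \<in> sets (distr M MX X)" "B \<in> sets (distr M MY Y)"
  then have [measurable]: "A \<in> sets MX" "B \<in> sets MY" by auto
  have "(\<lambda>\<omega>. (X \<omega>, Y \<omega>)) -` (A \<times> B) \<inter> space M = (X -` A \<inter> space M) \<inter> (Y -` B \<inter> space M)"
    by auto
  then show "emeasure (distr M MX X) A * emeasure (distr M MY Y) B
      = emeasure (distr M (MX \<Otimes>\<^sub>M MY) (\<lambda>\<omega>. (X \<omega>, Y \<omega>))) (A \<times> B)"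
    using ind \<open>A \<in> sets MX\<close> \<open>B \<in> sets MY\<close>
    by (simp add: emeasure_distr indep_rv_iff[OF \<open>prob_space M\<close> X Y] emeasure_eq_measure ennreal_mult)
qed simp

text \<open>On rectangles, first \<open>U\<close> is split off from the whole family
  \<open>\<xi>\<close>, then \<open>\<xi> i\<close> from \<open>tuple J \<xi>\<close>, giving a
  product of three probabilities. Rectangles are stable under intersection and generate the product
  algebra, so independence extends from them.\<close>

lemma indep_rv_add_component:
  assumes "prob_space M" and U[measurable]: "U \<in> M \<rightarrow>\<^sub>M MU"
    and iv: "prob_space.indep_vars M (\<lambda>_. N) \<xi> I"
    and ind: "indep_rv M (PiM I (\<lambda>_. N)) (tuple I \<xi>) MU U"
    and J: "J \<subseteq> I" and i: "i \<in> I" "i \<notin> J"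
  shows "indep_rv M (MU \<Otimes>\<^sub>M PiM J (\<lambda>_. N)) (\<lambda>\<omega>. (U \<omega>, tuple J \<xi> \<omega>)) N (\<xi> i)"
proof -
  interpret prob_space M by fact
  have \<xi>[measurable]: "\<xi> j \<in> M \<rightarrow>\<^sub>M N" if "j \<in> I" for j
    using iv that by (auto simp: indep_vars_def)
  have tup: "tuple K \<xi> \<in> M \<rightarrow>\<^sub>M PiM K (\<lambda>_. N)" if "K \<subseteq> I" for K
    using that unfolding tuple_def by (intro measurable_restrict) auto
  note [measurable] = tup[OF J] tup[OF order_refl]
  have UI: "prob ((U -` A \<inter> space M) \<inter> (tuple I \<xi> -` E \<inter> space M))
      = prob (U -` A \<inter> space M) * prob (tuple I \<xi> -` E \<inter> space M)"
    if "A \<in> sets MU" "E \<in> sets (PiM I (\<lambda>_. N))" for A E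
    using ind that by (simp add: indep_rv_iff[OF \<open>prob_space M\<close> tup[OF order_refl] U] Int_commute mult.commute)
  have Ji: "prob ((tuple J \<xi> -` E \<inter> space M) \<inter> (\<xi> i -` C \<inter> space M))
      = prob (tuple J \<xi> -` E \<inter> space M) * prob (\<xi> i -` C \<inter> space M)"
    if "E \<in> sets (PiM J (\<lambda>_. N))" and C: "C \<in> sets N" for E C
  proof -
    \<comment> \<open>\<open>indep_var\<close> needs both variables to have values of one type, so
      \<open>\<xi> i\<close> enters as a tuple over \<open>{i}\<close> and \<open>C\<close> is
      pulled back along the coordinate.\<close>
    have "indep_var (PiM J (\<lambda>_. N)) (tuple J \<xi>) (PiM {i} (\<lambda>_. N)) (tuple {i} \<xi>)"
      unfolding tuple_def using iv J i by (intro indep_var_restrict) auto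
    moreover have "(\<lambda>x. x i) -` C \<inter> space (PiM {i} (\<lambda>_. N)) \<in> sets (PiM {i} (\<lambda>_. N))"
      using C by measurable
    ultimately have "prob ((\<lambda>\<omega>. (tuple J \<xi> \<omega>, tuple {i} \<xi> \<omega>))
          -` (E \<times> ((\<lambda>x. x i) -` C \<inter> space (PiM {i} (\<lambda>_. N)))) \<inter> space M)
        = prob (tuple J \<xi> -` E \<inter> space M)
          * prob (tuple {i} \<xi> -` ((\<lambda>x. x i) -` C \<inter> space (PiM {i} (\<lambda>_. N))) \<inter> space M)"
      using that(1) by (intro indep_varD)
    moreover have "(\<lambda>\<omega>. (tuple J \<xi> \<omega>, tuple {i} \<xi> \<omega>))
          -` (E \<times> ((\<lambda>x. x i) -` C \<inter> space (PiM {i} (\<lambda>_. N)))) \<inter> space M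
        = (tuple J \<xi> -` E \<inter> space M) \<inter> (\<xi> i -` C \<inter> space M)"
      using measurable_space[OF tup[of "{i}"]] i(1) by (auto simp: tuple_def)
    moreover have "tuple {i} \<xi> -` ((\<lambda>x. x i) -` C \<inter> space (PiM {i} (\<lambda>_. N))) \<inter> space M
        = \<xi> i -` C \<inter> space M"
      using measurable_space[OF tup[of "{i}"]] i(1) by (auto simp: tuple_def)
    ultimately show ?thesis by simp
  qed
  \<comment> \<open>Joint events of \<open>tuple J \<xi>\<close> and \<open>\<xi> i\<close> are
    events of the full tuple, the only form to which \<open>UI\<close> applies.\<close>
  have restr: "\<exists>E'\<in>sets (PiM I (\<lambda>_. N)). tuple I \<xi> -` E' \<inter> space M
      = (tuple J \<xi> -` E \<inter> space M) \<inter> (\<xi> i -` C \<inter> space M)"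
    if [measurable]: "E \<in> sets (PiM J (\<lambda>_. N))" "C \<in> sets N" for E C
  proof
    have [measurable]: "(\<lambda>x. x i) \<in> PiM I (\<lambda>_. N) \<rightarrow>\<^sub>M N" using i(1) by measurable
    have [measurable]: "(\<lambda>x. restrict x J) \<in> PiM I (\<lambda>_. N) \<rightarrow>\<^sub>M PiM J (\<lambda>_. N)"
      by (rule measurable_restrict_subset[OF J])
    let ?E' = "{x \<in> space (PiM I (\<lambda>_. N)). restrict x J \<in> E \<and> x i \<in> C}"
    show "?E' \<in> sets (PiM I (\<lambda>_. N))" by measurable
    have "restrict (tuple I \<xi> \<omega>) J = tuple J \<xi> \<omega>" for \<omega>
      using J by (auto simp: tuple_def fun_eq_iff)
    then show "tuple I \<xi> -` ?E' \<inter> space M = (tuple J \<xi> -` E \<inter> space M) \<inter> (\<xi> i -` C \<inter> space M)"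
      using measurable_space[OF tup[OF order_refl]] i(1) by (auto simp: tuple_def)
  qed
  let ?f = "\<lambda>\<omega>. (U \<omega>, tuple J \<xi> \<omega>)"
  let ?R = "{?f -` (A \<times> E) \<inter> space M |A E. A \<in> sets MU \<and> E \<in> sets (PiM J (\<lambda>_. N))}"
  let ?S = "{\<xi> i -` C \<inter> space M |C. C \<in> sets N}"
  have rect: "?f -` (A \<times> E) \<inter> space M = (U -` A \<inter> space M) \<inter> (tuple J \<xi> -` E \<inter> space M)" for A E
    by auto
  have "indep_set (sigma_sets (space M) ?R) (sigma_sets (space M) ?S)"
  proof (rule indep_set_sigma_sets)
    show "indep_set ?R ?S"
    proof (rule indep_setI)
      show "?R \<subseteq> events" by auto
      show "?S \<subseteq> events" using \<xi>[OF i(1)] by auto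
      fix a b assume "a \<in> ?R" "b \<in> ?S"
      then obtain A E C where a: "a = ?f -` (A \<times> E) \<inter> space M" and b: "b = \<xi> i -` C \<inter> space M"
        and s: "A \<in> sets MU" "E \<in> sets (PiM J (\<lambda>_. N))" "C \<in> sets N" by blast
      obtain E1 where E1: "E1 \<in> sets (PiM I (\<lambda>_. N))"
        "tuple I \<xi> -` E1 \<inter> space M = (tuple J \<xi> -` E \<inter> space M) \<inter> b"
        using restr[OF s(2,3)] b by auto
      \<comment> \<open>Letting \<open>\<xi> i\<close> range over its whole space yields the event
        of \<open>tuple J \<xi>\<close> alone.\<close>
      obtain E2 where E2: "E2 \<in> sets (PiM I (\<lambda>_. N))"
        "tuple I \<xi> -` E2 \<inter> space M = tuple J \<xi> -` E \<inter> space M"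
        using restr[OF s(2) sets.top] measurable_space[OF \<xi>[OF i(1)]] by fastforce
      have "prob (a \<inter> b) = prob ((U -` A \<inter> space M) \<inter> (tuple I \<xi> -` E1 \<inter> space M))"
        unfolding a rect E1(2) by (simp add: Int_assoc)
      also have "\<dots> = prob (U -` A \<inter> space M) * prob (tuple J \<xi> -` E \<inter> space M) * prob b"
        using UI[OF s(1) E1(1)] Ji[OF s(2,3)] unfolding E1(2) b by (simp only: mult.assoc)
      also have "\<dots> = prob a * prob b"
        unfolding a rect using UI[OF s(1) E2(1)] by (simp add: E2(2))
      finally show "prob (a \<inter> b) = prob a * prob b" .
    qed
    show "Int_stable ?R"
    proof (rule Int_stableI)
      fix a b assume "a \<in> ?R" "b \<in> ?R"
      then obtain A E A' E' where ab: "a = ?f -` (A \<times> E) \<inter> space M" "b = ?f -` (A' \<times> E') \<inter> space M"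
        and s: "A \<in> sets MU" "E \<in> sets (PiM J (\<lambda>_. N))" "A' \<in> sets MU" "E' \<in> sets (PiM J (\<lambda>_. N))"
        by blast
      have "a \<inter> b = ?f -` ((A \<inter> A') \<times> (E \<inter> E')) \<inter> space M" using ab by auto
      then show "a \<inter> b \<in> ?R" using s by blast
    qed
    show "Int_stable ?S"
    proof (rule Int_stableI)
      fix a b assume "a \<in> ?S" "b \<in> ?S"
      then obtain A B where ab: "a = \<xi> i -` A \<inter> space M" "b = \<xi> i -` B \<inter> space M"
        and s: "A \<in> sets N" "B \<in> sets N" by blast
      have "a \<inter> b = \<xi> i -` (A \<inter> B) \<inter> space M" using ab by auto
      then show "a \<inter> b \<in> ?S" using s by blast
    qed
  qed
  \<comment> \<open>Taking preimages commutes with generating a sigma-algebra, so the preimages of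
    rectangles generate the algebra of the pair.\<close>
  moreover have "sets (vimage_algebra (space M) ?f (MU \<Otimes>\<^sub>M PiM J (\<lambda>_. N))) = sigma_sets (space M) ?R"
  proof -
    let ?G = "{A \<times> E |A E. A \<in> sets MU \<and> E \<in> sets (PiM J (\<lambda>_. N))}"
    let ?\<Omega> = "space MU \<times> space (PiM J (\<lambda>_. N))"
    have "sets (vimage_algebra (space M) ?f (MU \<Otimes>\<^sub>M PiM J (\<lambda>_. N)))
        = sets (vimage_algebra (space M) ?f (sigma ?\<Omega> ?G))"
      by (rule sets_vimage_algebra_cong) (simp add: sets_pair_measure pair_measure_closed sets_measure_of)
    also have "\<dots> = sets (sigma (space M) {?f -` A \<inter> space M |A. A \<in> ?G})"
      using measurable_space[OF U] measurable_space[OF tup[OF J]]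
      by (subst vimage_algebra_sigma[OF pair_measure_closed]) auto
    also have "{?f -` A \<inter> space M |A. A \<in> ?G} = ?R" by blast
    also have "sets (sigma (space M) ?R) = sigma_sets (space M) ?R"
      by (rule sets_measure_of) auto
    finally show ?thesis .
  qed
  ultimately show ?thesis
    unfolding indep_rv_def by (simp add: sets_vimage_algebra)
qed

section \<open>Joint laws dominated by product measures, along the iteration\<close>

text \<open>Domination is tested setwise, hence survives image measures, and the image of a product
  measure under \<open>f\<close> and \<open>g\<close> acting separately is the product of the
  images. This serves both to reshape histories and to post-process the iterates.\<close>

lemma distr_pair_dominated_map:
  assumes X[measurable]: "X \<in> M \<rightarrow>\<^sub>M MX" and Y[measurable]: "Y \<in> M \<rightarrow>\<^sub>M MY"
    and f[measurable]: "f \<in> MX \<rightarrow>\<^sub>M MX'" and g: "g \<in> MY \<rightarrow>\<^sub>M MY'"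
    and Q: "finite_measure Q" "sets Q = sets MY"
    and le: "distr M (MX \<Otimes>\<^sub>M MY) (\<lambda>\<omega>. (X \<omega>, Y \<omega>)) \<le> distr M MX X \<Otimes>\<^sub>M Q"
  shows "distr M (MX' \<Otimes>\<^sub>M MY') (\<lambda>\<omega>. (f (X \<omega>), g (Y \<omega>)))
    \<le> distr M MX' (\<lambda>\<omega>. f (X \<omega>)) \<Otimes>\<^sub>M distr Q MY' g"
proof -
  have gQ: "g \<in> Q \<rightarrow>\<^sub>M MY'"
    using g by (simp cong: measurable_cong_sets add: Q(2))
  note [measurable] = g gQ
  interpret Qg: finite_measure "distr Q MY' g"
    by (rule finite_measure.finite_measure_distr[OF Q(1) gQ])
  let ?h = "\<lambda>(x, y). (f x, g y)" and ?P = "distr M (MX \<Otimes>\<^sub>M MY) (\<lambda>\<omega>. (X \<omega>, Y \<omega>))"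
  have sP: "sets ?P = sets (distr M MX X \<Otimes>\<^sub>M Q)"
    by (simp add: Q(2) cong: sets_pair_measure_cong)
  have eqP: "distr M (MX' \<Otimes>\<^sub>M MY') (\<lambda>\<omega>. (f (X \<omega>), g (Y \<omega>))) = distr ?P (MX' \<Otimes>\<^sub>M MY') ?h"
    by (subst distr_distr) (auto simp: comp_def)
  have "distr M MX' (\<lambda>\<omega>. f (X \<omega>)) = distr (distr M MX X) MX' f"
    by (subst distr_distr) (auto simp: comp_def)
  then have eqR: "distr M MX' (\<lambda>\<omega>. f (X \<omega>)) \<Otimes>\<^sub>M distr Q MY' g
      = distr (distr M MX X \<Otimes>\<^sub>M Q) (MX' \<Otimes>\<^sub>M MY') ?h"
    using pair_measure_distr[of f "distr M MX X" MX' g Q MY'] gQ Qg.sigma_finite_measure_axioms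
    by simp
  have hR: "?h \<in> distr M MX X \<Otimes>\<^sub>M Q \<rightarrow>\<^sub>M MX' \<Otimes>\<^sub>M MY'" by measurable
  show ?thesis
    unfolding eqP eqR
  proof (subst le_measure)
    show "\<forall>A\<in>sets (distr ?P (MX' \<Otimes>\<^sub>M MY') ?h).
        emeasure (distr ?P (MX' \<Otimes>\<^sub>M MY') ?h) A
          \<le> emeasure (distr (distr M MX X \<Otimes>\<^sub>M Q) (MX' \<Otimes>\<^sub>M MY') ?h) A"
      using le_measureD3[OF le sP] sets_eq_imp_space_eq[OF sP] hR
      by (simp add: emeasure_distr)
  qed simp
qed

text \<open>By independence of the noise, the new value has conditional density
  \<open>f (v - \<phi> h y)\<close> given \<open>Y = y\<close> and \<open>H = h\<close>. Replacing
  it by its essential supremum over \<open>y\<close> gives a kernel from \<open>h\<close> alone;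
  attaching this kernel to \<open>Q\<close> yields \<open>Q'\<close>, and \<open>c\<close> bounds
  the mass of the kernel.\<close>

lemma dominated_step:
  fixes \<phi> :: "'h \<Rightarrow> 'y \<Rightarrow> 'v::euclidean_space" and f :: "'v \<Rightarrow> ennreal"
  assumes M: "prob_space M" and Y[measurable]: "Y \<in> M \<rightarrow>\<^sub>M MY" and H[measurable]: "H \<in> M \<rightarrow>\<^sub>M MH"
    and X: "distributed M lborel X f"
    and ind: "indep_rv M (MY \<Otimes>\<^sub>M MH) (\<lambda>\<omega>. (Y \<omega>, H \<omega>)) borel X"
    and \<phi>[measurable]: "case_prod \<phi> \<in> borel_measurable (MH \<Otimes>\<^sub>M MY)"
    and Q: "finite_measure Q" and sQ[measurable_cong]: "sets Q = sets MH"
    and le: "distr M (MY \<Otimes>\<^sub>M MH) (\<lambda>\<omega>. (Y \<omega>, H \<omega>)) \<le> distr M MY Y \<Otimes>\<^sub>M Q"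
    and c: "c \<noteq> \<infinity>" "\<And>h. h \<in> space MH \<Longrightarrow>
      (\<integral>\<^sup>+v. esssup (distr M MY Y) (\<lambda>y. f (v - \<phi> h y)) \<partial>lborel) \<le> c"
  shows "\<exists>Q'. finite_measure Q' \<and> sets Q' = sets (MH \<Otimes>\<^sub>M borel)
    \<and> emeasure Q' (space Q') \<le> c * emeasure Q (space Q)
    \<and> distr M (MY \<Otimes>\<^sub>M (MH \<Otimes>\<^sub>M borel)) (\<lambda>\<omega>. (Y \<omega>, H \<omega>, \<phi> (H \<omega>) (Y \<omega>) + X \<omega>))
        \<le> distr M MY Y \<Otimes>\<^sub>M Q'"
proof -
  interpret prob_space M by fact
  interpret Q: finite_measure Q by fact
  have Xm[measurable]: "X \<in> borel_measurable M" and fm[measurable]: "f \<in> borel_measurable borel"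
    using X by (auto simp: distributed_def)
  let ?\<nu> = "distr M MY Y" and ?P = "distr M (MY \<Otimes>\<^sub>M MH) (\<lambda>\<omega>. (Y \<omega>, H \<omega>))"
  let ?V = "\<lambda>\<omega>. \<phi> (H \<omega>) (Y \<omega>) + X \<omega>"
  interpret \<nu>: prob_space ?\<nu> by (rule prob_space_distr) simp
  interpret X: prob_space "distr M borel X" by (rule prob_space_distr) simp
  interpret Ql: pair_sigma_finite Q "lborel :: 'v measure" ..
  have spQ: "space Q = space MH" by (rule sets_eq_imp_space_eq[OF sQ])
  define q where "q y r = f (snd r - \<phi> (fst r) y)" for y and r :: "'h \<times> 'v"
  have q[measurable]: "case_prod q \<in> borel_measurable (?\<nu> \<Otimes>\<^sub>M (Q \<Otimes>\<^sub>M lborel))"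
    unfolding q_def by measurable
  define K where "K r = esssup ?\<nu> (\<lambda>y. q y r)" for r
  have K[measurable]: "K \<in> borel_measurable (Q \<Otimes>\<^sub>M lborel)"
    unfolding K_def by (rule borel_measurable_esssup) (unfold_locales, measurable)
  define Q' where "Q' = density (Q \<Otimes>\<^sub>M lborel) K"
  have sQ': "sets Q' = sets (MH \<Otimes>\<^sub>M borel)"
    unfolding Q'_def using sQ by (simp cong: sets_pair_measure_cong)
  have "emeasure Q' (space Q') = (\<integral>\<^sup>+r. K r \<partial>(Q \<Otimes>\<^sub>M lborel))"
    unfolding Q'_def space_density emeasure_density[OF K sets.top] by (intro nn_integral_cong) simp
  also have "\<dots> = (\<integral>\<^sup>+h. \<integral>\<^sup>+v. K (h, v) \<partial>lborel \<partial>Q)"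
    by (simp add: lborel.nn_integral_fst)
  also have "\<dots> \<le> (\<integral>\<^sup>+h. c \<partial>Q)"
    using c(2) by (intro nn_integral_mono) (simp add: K_def q_def spQ)
  finally have mass: "emeasure Q' (space Q') \<le> c * emeasure Q (space Q)" by simp
  then have fin: "finite_measure Q'"
    using c(1) Q.emeasure_finite[of "space Q"]
    by (intro finite_measureI) (auto simp: top_unique ennreal_mult_eq_top_iff)
  interpret Q': finite_measure Q' by fact
  have s: "sets (distr M (MY \<Otimes>\<^sub>M (MH \<Otimes>\<^sub>M borel)) (\<lambda>\<omega>. (Y \<omega>, H \<omega>, ?V \<omega>))) = sets (?\<nu> \<Otimes>\<^sub>M Q')"
    using sQ' by (simp cong: sets_pair_measure_cong)
  have "distr M (MY \<Otimes>\<^sub>M (MH \<Otimes>\<^sub>M borel)) (\<lambda>\<omega>. (Y \<omega>, H \<omega>, ?V \<omega>)) \<le> ?\<nu> \<Otimes>\<^sub>M Q'"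
    unfolding le_measure[OF s]
  proof
    fix A assume "A \<in> sets (distr M (MY \<Otimes>\<^sub>M (MH \<Otimes>\<^sub>M borel)) (\<lambda>\<omega>. (Y \<omega>, H \<omega>, ?V \<omega>)))"
    then have A[measurable]: "A \<in> sets (MY \<Otimes>\<^sub>M (MH \<Otimes>\<^sub>M borel))" by simp
    define G where "G y r = (indicator A (y, r) :: ennreal)" for y and r :: "'h \<times> 'v"
    have G[measurable]: "case_prod G \<in> borel_measurable (MY \<Otimes>\<^sub>M (MH \<Otimes>\<^sub>M borel))"
      unfolding G_def by measurable
    have G'[measurable]: "case_prod G \<in> borel_measurable (?\<nu> \<Otimes>\<^sub>M (Q \<Otimes>\<^sub>M lborel))"
      by measurable
    have G\<phi>[measurable]: "(\<lambda>((y, h), x). G y (h, \<phi> h y + x))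
        \<in> borel_measurable ((MY \<Otimes>\<^sub>M MH) \<Otimes>\<^sub>M borel)"
      unfolding G_def case_prod_beta by measurable
    have "emeasure (distr M (MY \<Otimes>\<^sub>M (MH \<Otimes>\<^sub>M borel)) (\<lambda>\<omega>. (Y \<omega>, H \<omega>, ?V \<omega>))) A
        = (\<integral>\<^sup>+x. indicator A x \<partial>distr M (MY \<Otimes>\<^sub>M (MH \<Otimes>\<^sub>M borel)) (\<lambda>\<omega>. (Y \<omega>, H \<omega>, ?V \<omega>)))"
      by simp
    also have "\<dots> = (\<integral>\<^sup>+\<omega>. G (Y \<omega>) (H \<omega>, ?V \<omega>) \<partial>M)"
      unfolding G_def by (rule nn_integral_distr) measurable
    also have "\<dots> = (\<integral>\<^sup>+((y, h), x). G y (h, \<phi> h y + x)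
        \<partial>distr M ((MY \<Otimes>\<^sub>M MH) \<Otimes>\<^sub>M borel) (\<lambda>\<omega>. ((Y \<omega>, H \<omega>), X \<omega>)))"
      by (subst nn_integral_distr) auto
    also have "\<dots> = (\<integral>\<^sup>+((y, h), x). G y (h, \<phi> h y + x) \<partial>(?P \<Otimes>\<^sub>M distr M borel X))"
      \<comment> \<open>The pair \<open>(Y, H)\<close> is grouped on the left so that the
        independence of the noise from both splits the joint law.\<close>
      by (subst distr_pair_indep_rv[OF M _ _ ind]) auto
    also have "\<dots> = (\<integral>\<^sup>+(y, h). (\<integral>\<^sup>+x. G y (h, \<phi> h y + x) \<partial>distr M borel X) \<partial>?P)"
      by (subst X.nn_integral_fst[symmetric]) (auto simp: case_prod_beta')
    also have "\<dots> = (\<integral>\<^sup>+(y, h). (\<integral>\<^sup>+v. G y (h, v) * q y (h, v) \<partial>lborel) \<partial>?P)"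
    proof (intro nn_integral_cong, clarsimp simp: space_pair_measure)
      fix y h assume yh[measurable]: "y \<in> space MY" "h \<in> space MH"
      have [measurable]: "(\<lambda>v. G y (h, v)) \<in> borel_measurable borel"
        using measurable_compose[OF _ G, of "\<lambda>v. (y, h, v)" borel] yh by simp
      have "(\<integral>\<^sup>+x. G y (h, \<phi> h y + x) \<partial>distr M borel X)
          = (\<integral>\<^sup>+x. G y (h, \<phi> h y + x) \<partial>distr M lborel X)"
        by (simp cong: distr_cong)
      also have "\<dots> = (\<integral>\<^sup>+x. G y (h, \<phi> h y + x) * f x \<partial>lborel)"
        using distributed_distr_eq_density[OF X] by (simp add: nn_integral_density mult.commute)
      \<comment> \<open>Since \<open>q y (h, \<phi> h y + x) = f x\<close>, the integrand becomes a
        function of the shifted variable, ready for translation invariance.\<close>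
      also have "\<dots> = (\<integral>\<^sup>+x. G y (h, \<phi> h y + x) * q y (h, \<phi> h y + x) \<partial>lborel)"
        by (simp add: q_def)
      also have "\<dots> = (\<integral>\<^sup>+v. G y (h, v) * q y (h, v) \<partial>lborel)"
        by (rule nn_integral_lborel_shift) (simp add: q_def)
      finally show "(\<integral>\<^sup>+x. G y (h, \<phi> h y + x) \<partial>distr M borel X)
          = (\<integral>\<^sup>+v. G y (h, v) * q y (h, v) \<partial>lborel)" .
    qed
    also have "\<dots> \<le> (\<integral>\<^sup>+(y, r). G y r \<partial>(?\<nu> \<Otimes>\<^sub>M density (Q \<Otimes>\<^sub>M lborel) K))"
    proof (rule nn_integral_transition_le)
      show "sigma_finite_measure ?\<nu>" "sigma_finite_measure Q" "sigma_finite_measure (lborel :: 'v measure)"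
        by unfold_locales
      show "sets ?P = sets (?\<nu> \<Otimes>\<^sub>M Q)" using sQ by (simp cong: sets_pair_measure_cong)
      show "sigma_finite_measure (density (Q \<Otimes>\<^sub>M lborel) K)"
        using Q'.sigma_finite_measure_axioms by (simp add: Q'_def)
    qed (use le in \<open>simp_all add: K_def fun_eq_iff\<close>)
    also have "\<dots> = (\<integral>\<^sup>+x. indicator A x \<partial>(?\<nu> \<Otimes>\<^sub>M Q'))"
      by (simp add: G_def Q'_def)
    also have "\<dots> = emeasure (?\<nu> \<Otimes>\<^sub>M Q') A"
      using A by (intro nn_integral_indicator) (simp only: s[symmetric] sets_distr)
    finally show "emeasure (distr M (MY \<Otimes>\<^sub>M (MH \<Otimes>\<^sub>M borel)) (\<lambda>\<omega>. (Y \<omega>, H \<omega>, ?V \<omega>))) A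
        \<le> emeasure (?\<nu> \<Otimes>\<^sub>M Q') A" .
  qed
  then show ?thesis using fin sQ' mass by blast
qed

text \<open>\<open>Y\<close> is fixed throughout and only the history grows. The whole history is
  retained because the output may depend on all iterates.\<close>

lemma iterates_dominated:
  fixes W \<xi> :: "nat \<Rightarrow> 'w \<Rightarrow> 'v::euclidean_space" and \<phi> :: "nat \<Rightarrow> 'v \<Rightarrow> 'y \<Rightarrow> 'v"
    and f :: "nat \<Rightarrow> 'v \<Rightarrow> ennreal"
  assumes M: "prob_space M" and Y[measurable]: "Y \<in> M \<rightarrow>\<^sub>M MY"
    and W0[measurable]: "W 0 \<in> borel_measurable M"
    and f: "\<And>t. t \<in> {1..T} \<Longrightarrow> distributed M lborel (\<xi> t) (f t)"
    and ind0: "indep_rv M borel (W 0) MY Y"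
    and iv: "prob_space.indep_vars M (\<lambda>_. borel) \<xi> {1..T}"
    and ind: "indep_rv M (PiM {1..T} (\<lambda>_. borel)) (tuple {1..T} \<xi>) (borel \<Otimes>\<^sub>M MY) (\<lambda>\<omega>. (W 0 \<omega>, Y \<omega>))"
    and \<phi>: "\<And>t. t \<in> {1..T} \<Longrightarrow> case_prod (\<phi> t) \<in> borel_measurable (borel \<Otimes>\<^sub>M MY)"
    and W: "\<And>t \<omega>. t \<in> {1..T} \<Longrightarrow> \<omega> \<in> space M \<Longrightarrow> W t \<omega> = \<phi> t (W (t - 1) \<omega>) (Y \<omega>) + \<xi> t \<omega>"
    and c: "\<And>t. t \<in> {1..T} \<Longrightarrow> c t \<noteq> \<infinity>"
    and esssup_le: "\<And>t w. t \<in> {1..T} \<Longrightarrow>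
      (\<integral>\<^sup>+v. esssup (distr M MY Y) (\<lambda>y. f t (v - \<phi> t w y)) \<partial>lborel) \<le> c t"
  shows "\<exists>Q. finite_measure Q \<and> sets Q = sets (PiM {0..T} (\<lambda>_. borel :: 'v measure))
    \<and> emeasure Q (space Q) \<le> (\<Prod>t=1..T. c t)
    \<and> distr M (MY \<Otimes>\<^sub>M PiM {0..T} (\<lambda>_. borel)) (\<lambda>\<omega>. (Y \<omega>, tuple {0..T} W \<omega>)) \<le> distr M MY Y \<Otimes>\<^sub>M Q"
proof -
  interpret prob_space M by fact
  have \<xi>[measurable]: "\<xi> t \<in> borel_measurable M" if "t \<in> {1..T}" for t
    using f[OF that] by (auto simp: distributed_def)
  have "\<exists>Q. finite_measure Q \<and> sets Q = sets (PiM {0..s} (\<lambda>_. borel :: 'v measure))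
    \<and> emeasure Q (space Q) \<le> (\<Prod>t=1..s. c t)
    \<and> distr M (MY \<Otimes>\<^sub>M PiM {0..s} (\<lambda>_. borel)) (\<lambda>\<omega>. (Y \<omega>, tuple {0..s} W \<omega>)) \<le> distr M MY Y \<Otimes>\<^sub>M Q"
    if "s \<le> T" for s
    using that
  proof (induction s)
    case 0
    \<comment> \<open>At time \<open>0\<close> the history is a tuple with one entry. Independence
      of \<open>W 0\<close> and \<open>Y\<close> makes the joint law a product, and the mass
      \<open>1\<close> matches the empty product.\<close>
    let ?g = "\<lambda>w::'v. \<lambda>i\<in>{0::nat..0}. w"
    have g[measurable]: "?g \<in> borel \<rightarrow>\<^sub>M PiM {0..0} (\<lambda>_. borel)"
      by (intro measurable_restrict) simp
    interpret D: prob_space "distr M borel (W 0)" by (rule prob_space_distr) simp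
    let ?Q = "distr (distr M borel (W 0)) (PiM {0..0} (\<lambda>_. borel)) ?g"
    interpret Q: prob_space ?Q by (rule D.prob_space_distr) simp
    have "distr M (MY \<Otimes>\<^sub>M borel) (\<lambda>\<omega>. (Y \<omega>, W 0 \<omega>)) = distr M MY Y \<Otimes>\<^sub>M distr M borel (W 0)"
      by (intro distr_pair_indep_rv M Y W0 indep_rv_commute[OF M W0 Y ind0])
    then have "distr M (MY \<Otimes>\<^sub>M PiM {0..0} (\<lambda>_. borel)) (\<lambda>\<omega>. (Y \<omega>, ?g (W 0 \<omega>))) \<le> distr M MY Y \<Otimes>\<^sub>M ?Q"
      using D.finite_measure_axioms
      by (intro distr_pair_dominated_map[OF Y W0 _ g, of "\<lambda>y. y"]) auto
    moreover have tup: "tuple {0..0} W = (\<lambda>\<omega>. ?g (W 0 \<omega>))"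
      by (auto simp: tuple_def fun_eq_iff)
    ultimately have le: "distr M (MY \<Otimes>\<^sub>M PiM {0..0} (\<lambda>_. borel)) (\<lambda>\<omega>. (Y \<omega>, tuple {0..0} W \<omega>))
        \<le> distr M MY Y \<Otimes>\<^sub>M ?Q"
      by (simp only: tup)
    have mass: "emeasure ?Q (space ?Q) \<le> (\<Prod>t=1..0. c t)"
      using Q.emeasure_space_1 by simp
    show ?case
      by (intro exI[of _ ?Q] conjI Q.finite_measure_axioms sets_distr mass le)
  next
    case (Suc s)
    then have s: "Suc s \<in> {1..T}" "s \<le> T" by auto
    define H where "H = tuple {0..s} W"
    \<comment> \<open>\<open>U\<close> collects the randomness behind the first \<open>s\<close>
      updates. By the update rule \<open>W 0\<close> up to \<open>W s\<close> are measurable for its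
      algebra \<open>A\<close>, so the independence of the next noise from \<open>U\<close> passes
      to \<open>Y\<close> and the history.\<close>
    define U where "U \<omega> = ((W 0 \<omega>, Y \<omega>), tuple {1..s} \<xi> \<omega>)" for \<omega>
    define MU where "MU = ((borel :: 'v measure) \<Otimes>\<^sub>M MY) \<Otimes>\<^sub>M PiM {1..s} (\<lambda>_. borel :: 'v measure)"
    have U[measurable]: "U \<in> M \<rightarrow>\<^sub>M MU"
      unfolding U_def MU_def tuple_def using s by (intro measurable_Pair measurable_restrict) auto
    define A where "A = vimage_algebra (space M) U MU"
    have UA: "U \<in> A \<rightarrow>\<^sub>M MU"
      unfolding A_def using measurable_space[OF U] by (intro measurable_vimage_algebra1) auto
    have spA: "space A = space M" by (simp add: A_def)
    have YA[measurable]: "Y \<in> A \<rightarrow>\<^sub>M MY"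
      using measurable_compose[OF UA, of "\<lambda>u. snd (fst u)" MY] by (simp add: U_def MU_def)
    have \<xi>A: "\<xi> i \<in> borel_measurable A" if "i \<in> {1..s}" for i
      using measurable_compose[OF UA, of "\<lambda>u. snd u i" borel] that by (simp add: U_def MU_def tuple_def)
    have WA: "W i \<in> borel_measurable A" if "i \<le> s" for i
      using that
    proof (induction i)
      case 0
      show ?case
        using measurable_compose[OF UA, of "\<lambda>u. fst (fst u)" borel] by (simp add: U_def MU_def)
    next
      case (Suc i)
      then have i: "Suc i \<in> {1..T}" "Suc i \<in> {1..s}" "W i \<in> borel_measurable A"
        using s by auto
      have "(\<lambda>\<omega>. \<phi> (Suc i) (W i \<omega>) (Y \<omega>) + \<xi> (Suc i) \<omega>) \<in> borel_measurable A"
        using measurable_compose[OF measurable_Pair[OF i(3) YA] \<phi>[OF i(1)]] \<xi>A[OF i(2)] by simp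
      then show ?case
        by (rule measurable_cong[THEN iffD2, rotated]) (use W[OF i(1)] in \<open>simp add: spA\<close>)
    qed
    have HA[measurable]: "H \<in> A \<rightarrow>\<^sub>M PiM {0..s} (\<lambda>_. borel)"
      unfolding H_def tuple_def using WA by (intro measurable_restrict) auto
    have AM: "h \<in> M \<rightarrow>\<^sub>M N" if "h \<in> A \<rightarrow>\<^sub>M N" for h :: "'w \<Rightarrow> 'b" and N
    proof (rule measurableI)
      have sA: "sets A \<subseteq> events"
        unfolding A_def using measurable_sets[OF U] by (intro sets_image_in_sets') auto
      show "h x \<in> space N" if "x \<in> space M" for x
        using measurable_space[OF \<open>h \<in> A \<rightarrow>\<^sub>M N\<close>] that by (simp add: spA)
      show "h -` B \<inter> space M \<in> events" if "B \<in> sets N" for B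
        using measurable_sets[OF \<open>h \<in> A \<rightarrow>\<^sub>M N\<close> that] sA by (auto simp: spA)
    qed
    have H[measurable]: "H \<in> M \<rightarrow>\<^sub>M PiM {0..s} (\<lambda>_. borel)" by (rule AM[OF HA])
    have UW: "(\<lambda>\<omega>. (W 0 \<omega>, Y \<omega>)) \<in> M \<rightarrow>\<^sub>M borel \<Otimes>\<^sub>M MY" by measurable
    have "indep_rv M MU U borel (\<xi> (Suc s))"
      unfolding MU_def U_def using s
      by (intro indep_rv_add_component[OF M UW iv ind]) auto
    then have indH: "indep_rv M (MY \<Otimes>\<^sub>M PiM {0..s} (\<lambda>_. borel)) (\<lambda>\<omega>. (Y \<omega>, H \<omega>)) borel (\<xi> (Suc s))"
      by (rule indep_rv_measurable_left[OF M U \<xi>[OF s(1)] _ measurable_Pair[OF YA HA, unfolded A_def]])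
    obtain Q where Q: "finite_measure Q" "sets Q = sets (PiM {0..s} (\<lambda>_. borel :: 'v measure))"
      "emeasure Q (space Q) \<le> (\<Prod>t=1..s. c t)"
      "distr M (MY \<Otimes>\<^sub>M PiM {0..s} (\<lambda>_. borel)) (\<lambda>\<omega>. (Y \<omega>, H \<omega>)) \<le> distr M MY Y \<Otimes>\<^sub>M Q"
      using Suc.IH[OF s(2), folded H_def] by (elim exE conjE) (rule that)
    let ?\<phi> = "\<lambda>h y. \<phi> (Suc s) (h s) y"
    let ?H' = "\<lambda>\<omega>. (H \<omega>, ?\<phi> (H \<omega>) (Y \<omega>) + \<xi> (Suc s) \<omega>)"
    let ?N = "PiM {0..s} (\<lambda>_. borel :: 'v measure)"
    have \<phi>': "case_prod ?\<phi> \<in> borel_measurable (?N \<Otimes>\<^sub>M MY)"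
    proof -
      have "(\<lambda>x. (fst x s, snd x)) \<in> ?N \<Otimes>\<^sub>M MY \<rightarrow>\<^sub>M borel \<Otimes>\<^sub>M MY"
        by (intro measurable_Pair measurable_compose[OF measurable_fst measurable_component_singleton]) auto
      from measurable_compose[OF this \<phi>[OF s(1)]] show ?thesis by (simp add: case_prod_beta')
    qed
    obtain Q' where Q': "finite_measure Q'" "sets Q' = sets (?N \<Otimes>\<^sub>M borel)"
      "emeasure Q' (space Q') \<le> c (Suc s) * emeasure Q (space Q)"
      "distr M (MY \<Otimes>\<^sub>M (?N \<Otimes>\<^sub>M borel)) (\<lambda>\<omega>. (Y \<omega>, ?H' \<omega>)) \<le> distr M MY Y \<Otimes>\<^sub>M Q'"
      using dominated_step[OF M Y H f[OF s(1)] indH \<phi>' Q(1,2,4) c[OF s(1)] esssup_le[OF s(1)]]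
      by (elim exE conjE) (rule that)
    interpret Q': finite_measure Q' by fact
    \<comment> \<open>The pair of old history and new value is turned into a history on
      \<open>{0..Suc s}\<close>.\<close>
    let ?g = "\<lambda>(h::nat \<Rightarrow> 'v, v). h(Suc s := v)"
    have g: "?g \<in> ?N \<Otimes>\<^sub>M borel \<rightarrow>\<^sub>M PiM {0..Suc s} (\<lambda>_. borel)"
      using measurable_add_dim[of "Suc s" "{0..s}" "\<lambda>_. borel"]
      by (simp add: atLeast0_atMost_Suc)
    then have gQ: "?g \<in> Q' \<rightarrow>\<^sub>M PiM {0..Suc s} (\<lambda>_. borel)"
      by (simp cong: measurable_cong_sets add: Q'(2))
    have H': "?H' \<in> M \<rightarrow>\<^sub>M ?N \<Otimes>\<^sub>M borel"
      using measurable_compose[OF measurable_Pair[OF H Y] \<phi>'] H \<xi>[OF s(1)] by simp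
    let ?Q = "distr Q' (PiM {0..Suc s} (\<lambda>_. borel)) ?g"
    have "distr M (MY \<Otimes>\<^sub>M PiM {0..Suc s} (\<lambda>_. borel)) (\<lambda>\<omega>. (Y \<omega>, ?g (?H' \<omega>))) \<le> distr M MY Y \<Otimes>\<^sub>M ?Q"
      by (rule distr_pair_dominated_map[OF Y H' measurable_ident_sets[OF refl] g Q'(1,2,4)])
    moreover have "distr M (MY \<Otimes>\<^sub>M PiM {0..Suc s} (\<lambda>_. borel)) (\<lambda>\<omega>. (Y \<omega>, ?g (?H' \<omega>)))
        = distr M (MY \<Otimes>\<^sub>M PiM {0..Suc s} (\<lambda>_. borel)) (\<lambda>\<omega>. (Y \<omega>, tuple {0..Suc s} W \<omega>))"
      using W[OF s(1)] by (intro distr_cong) (auto simp: H_def tuple_def fun_eq_iff)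
    moreover have "emeasure ?Q (space ?Q) \<le> (\<Prod>t=1..Suc s. c t)"
    proof -
      have "emeasure ?Q (space ?Q) = emeasure Q' (space Q')"
        using gQ measurable_space[OF gQ] by (subst emeasure_distr) (auto intro!: arg_cong[where f="emeasure Q'"])
      also have "\<dots> \<le> c (Suc s) * (\<Prod>t=1..s. c t)"
        using Q'(3) mult_left_mono[OF Q(3)] by (rule order_trans) simp
      finally show ?thesis by (simp add: mult.commute)
    qed
    ultimately show ?case
      using Q'.finite_measure_distr[OF gQ] by (intro exI[of _ ?Q]) simp
  qed
  from this[OF order_refl] show ?thesis .
qed

section \<open>From domination to maximal leakage\<close>

text \<open>Dividing \<open>Q\<close> by its mass gives a probability measure that is admissible in
  the infimum, and the mass, at most \<open>C\<close>, reappears as the factor in the setwise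
  bound.\<close>

lemma maximal_leakage_le:
  assumes M: "prob_space M" and X[measurable]: "X \<in> M \<rightarrow>\<^sub>M MX" and Y[measurable]: "Y \<in> M \<rightarrow>\<^sub>M MY"
    and Q: "finite_measure Q" and sQ: "sets Q = sets MY"
    and C: "C \<noteq> \<infinity>" "emeasure Q (space Q) \<le> C"
    and le: "distr M (MX \<Otimes>\<^sub>M MY) (\<lambda>\<omega>. (X \<omega>, Y \<omega>)) \<le> distr M MX X \<Otimes>\<^sub>M Q"
  shows "maximal_leakage M MX X MY Y \<le> ln_ennreal C"
proof -
  interpret prob_space M by fact
  interpret Q: finite_measure Q by fact
  let ?P = "distr M (MX \<Otimes>\<^sub>M MY) (\<lambda>\<omega>. (X \<omega>, Y \<omega>))" and ?\<nu> = "distr M MX X"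
  interpret \<nu>: prob_space ?\<nu> by (rule prob_space_distr) simp
  interpret P: prob_space ?P by (rule prob_space_distr) simp
  define m where "m = emeasure Q (space Q)"
  have s: "sets ?P = sets (?\<nu> \<Otimes>\<^sub>M Q)" using sQ by (simp cong: sets_pair_measure_cong)
  \<comment> \<open>Comparing total masses shows that a measure dominating a probability law has
    mass at least \<open>1\<close>, so the division by \<open>m\<close> is legitimate.\<close>
  have "1 = emeasure ?P (space ?P)" by (rule P.emeasure_space_1[symmetric])
  also have "\<dots> \<le> emeasure (?\<nu> \<Otimes>\<^sub>M Q) (space ?P)" by (rule le_measureD3[OF le s])
  also have "space ?P = space ?\<nu> \<times> space Q"
    using sets_eq_imp_space_eq[OF sQ] by (simp add: space_pair_measure)
  also have "emeasure (?\<nu> \<Otimes>\<^sub>M Q) \<dots> = m"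
    by (subst Q.emeasure_pair_measure_Times) (simp_all add: \<nu>.emeasure_space_1[simplified] m_def)
  finally have m1: "1 \<le> m" .
  have mfin: "m \<noteq> \<infinity>" by (simp add: m_def)
  have m: "m * (1 / m) = 1"
    using m1 mfin by (cases m) (auto simp: ennreal_1[symmetric] divide_ennreal ennreal_mult[symmetric] simp del: ennreal_1)
  define Q1 where "Q1 = scale_measure (1 / m) Q"
  have sQ1: "sets Q1 = sets MY" using sQ by (simp add: Q1_def)
  interpret Q1: prob_space Q1
    by standard (use m in \<open>simp add: Q1_def m_def mult.commute space_scale_measure\<close>)
  interpret R: pair_prob_space ?\<nu> Q1 ..
  have "renyi_div_inf ?P (?\<nu> \<Otimes>\<^sub>M Q1) \<le> ln_ennreal C"
  proof (rule renyi_div_inf_le[OF R.prob_space_axioms _ C(1)])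
    show sP: "sets ?P = sets (?\<nu> \<Otimes>\<^sub>M Q1)"
      using sQ1 by (simp cong: sets_pair_measure_cong)
    fix A assume A: "A \<in> sets (?\<nu> \<Otimes>\<^sub>M Q1)"
    then have A': "A \<in> sets (?\<nu> \<Otimes>\<^sub>M Q)" using s sP by simp
    have "emeasure ?P A \<le> emeasure (?\<nu> \<Otimes>\<^sub>M Q) A" by (rule le_measureD3[OF le s])
    also have "\<dots> = (\<integral>\<^sup>+x. emeasure Q (Pair x -` A) \<partial>?\<nu>)"
      by (rule Q.emeasure_pair_measure_alt[OF A'])
    also have "\<dots> = (\<integral>\<^sup>+x. m * emeasure Q1 (Pair x -` A) \<partial>?\<nu>)"
      by (simp add: Q1_def mult.assoc[symmetric] m)
    also have "\<dots> = m * emeasure (?\<nu> \<Otimes>\<^sub>M Q1) A"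
      using Q1.measurable_emeasure_Pair[OF A]
      by (simp add: Q1.emeasure_pair_measure_alt[OF A] nn_integral_cmult)
    also have "\<dots> \<le> C * emeasure (?\<nu> \<Otimes>\<^sub>M Q1) A"
      using C(2) by (intro mult_right_mono) (simp_all add: m_def)
    finally show "emeasure ?P A \<le> C * emeasure (?\<nu> \<Otimes>\<^sub>M Q1) A" .
  qed
  then show ?thesis
    unfolding maximal_leakage_def
    using Q1.prob_space_axioms sQ1 by (intro INF_lower2[of Q1]) auto
qed

section \<open>The leakage bound for the noisy iteration\<close>

theorem proposition3:
  fixes M :: "'w measure"
    and N \<mu> :: "'z measure"
    and B :: "'z multiset measure"
    and Out :: "'o measure"
    and n T :: nat
    and p :: ennreal
    and L :: real
    and \<eta> :: "nat \<Rightarrow> real"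
    and Z' :: "nat \<Rightarrow> 'w \<Rightarrow> 'z"
    and Z :: "nat \<Rightarrow> 'w \<Rightarrow> 'z multiset"
    and W \<xi> :: "nat \<Rightarrow> 'w \<Rightarrow> real ^ 'd"
    and g :: "real ^ 'd \<Rightarrow> real ^ 'd"
    and F :: "real ^ 'd \<Rightarrow> 'z multiset \<Rightarrow> real ^ 'd"
    and f :: "nat \<Rightarrow> real ^ 'd \<Rightarrow> real"
    and out :: "(nat \<Rightarrow> real ^ 'd) \<Rightarrow> 'o"
  assumes "prob_space M"
    and "p > 0" and "L > 0" and "\<And>t. t \<in> {1..T} \<Longrightarrow> \<eta> t > 0"
    \<comment> \<open>the data set: i.i.d. samples\<close>
    and "prob_space.indep_vars M (\<lambda>_. N) Z' {1..n}"
    and "\<And>i. i \<in> {1..n} \<Longrightarrow> distr M N (Z' i) = \<mu>"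
    \<comment> \<open>the mini-batches: random sub-collections of the data set\<close>
    and "\<And>t. t \<in> {1..T} \<Longrightarrow> Z t \<in> M \<rightarrow>\<^sub>M B"
    and "\<And>t \<omega>. t \<in> {1..T} \<Longrightarrow> \<omega> \<in> space M \<Longrightarrow>
           Z t \<omega> \<subseteq># image_mset (\<lambda>i. Z' i \<omega>) (mset_set {1..n})"
    \<comment> \<open>the noise and its densities, maximal at the origin\<close>
    and "\<And>t x. t \<in> {1..T} \<Longrightarrow> 0 \<le> f t x"
    and "\<And>t. t \<in> {1..T} \<Longrightarrow> distributed M lborel (\<xi> t) (\<lambda>x. ennreal (f t x))"
    and "\<And>t x. t \<in> {1..T} \<Longrightarrow> f t x \<le> f t 0"
    \<comment> \<open>the initial point and independence\<close>
    and "W 0 \<in> borel_measurable M"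
    and "indep_rv M borel (W 0)
           (PiM {1..n} (\<lambda>_. N) \<Otimes>\<^sub>M PiM {1..T} (\<lambda>_. B)) (\<lambda>\<omega>. (tuple {1..n} Z' \<omega>, tuple {1..T} Z \<omega>))"
    and "prob_space.indep_vars M (\<lambda>_. borel) \<xi> {1..T}"
    and "indep_rv M (PiM {1..T} (\<lambda>_. borel)) (tuple {1..T} \<xi>)
           (borel \<Otimes>\<^sub>M PiM {1..n} (\<lambda>_. N) \<Otimes>\<^sub>M PiM {1..T} (\<lambda>_. B)) (\<lambda>\<omega>. (W 0 \<omega>, tuple {1..n} Z' \<omega>, tuple {1..T} Z \<omega>))"
    \<comment> \<open>the update rule\<close>
    and "g \<in> borel_measurable borel"
    and "(\<lambda>(w, z). F w z) \<in> borel_measurable (borel \<Otimes>\<^sub>M B)"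
    and "\<And>t \<omega>. t \<in> {1..T} \<Longrightarrow> \<omega> \<in> space M \<Longrightarrow>
           W t \<omega> = g (W (t - 1) \<omega>) - \<eta> t *\<^sub>R F (W (t - 1) \<omega>) (Z t \<omega>) + \<xi> t \<omega>"
    and "\<And>w z. z \<in> space B \<Longrightarrow> lp_norm p (F w z) \<le> L"
    \<comment> \<open>the sampling strategy is agnostic to the parameter vectors\<close>
    and "\<And>t. t < T \<Longrightarrow>
           same_cond_law M B (Z (Suc t))
             (PiM {1..t} (\<lambda>_. B) \<Otimes>\<^sub>M PiM {1..t} (\<lambda>_. borel) \<Otimes>\<^sub>M PiM {1..n} (\<lambda>_. N))
             (\<lambda>\<omega>. (tuple {1..t} Z \<omega>, tuple {1..t} W \<omega>, tuple {1..n} Z' \<omega>))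
             (PiM {1..t} (\<lambda>_. B) \<Otimes>\<^sub>M PiM {1..n} (\<lambda>_. N))
             (\<lambda>\<omega>. (tuple {1..t} Z \<omega>, tuple {1..n} Z' \<omega>))"
    \<comment> \<open>the final output is a function of the iterates\<close>
    and "out \<in> PiM {1..T} (\<lambda>_. borel) \<rightarrow>\<^sub>M Out"
  shows "maximal_leakage M (PiM {1..n} (\<lambda>_. N)) (tuple {1..n} Z') Out (\<lambda>\<omega>. out (tuple {1..T} W \<omega>))
         \<le> (\<Sum>t = 1..T. ln_ennreal (ennreal (f t 0) * lp_ball_vol TYPE('d) p (\<eta> t * L)
                                   + h_tail p (f t) (\<eta> t * L)))"
proof (cases "\<forall>t\<in>{1..T}. ennreal (f t 0) * lp_ball_vol TYPE('d) p (\<eta> t * L) + h_tail p (f t) (\<eta> t * L) \<noteq> \<infinity>")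
  case fin: True
  note M = assms(1) and p = assms(2) and L = assms(3) and \<eta> = assms(4) and indZ' = assms(5)
    and Z = assms(7) and f = assms(10) and fmax = assms(11) and W0 = assms(12)
    and indW0 = assms(13) and ind\<xi> = assms(14) and ind = assms(15) and g = assms(16)
    and F = assms(17) and W = assms(18) and FL = assms(19) and out = assms(21)
  interpret prob_space M by (rule M)
  define c where "c t = ennreal (f t 0) * lp_ball_vol TYPE('d) p (\<eta> t * L) + h_tail p (f t) (\<eta> t * L)" for t
  \<comment> \<open>Bundling all mini-batches with the data lets one fixed variable drive every
    update; \<open>\<phi>\<close> reads the batch of time \<open>t\<close> from its second
    component.\<close>
  define Y where "Y \<omega> = (tuple {1..n} Z' \<omega>, tuple {1..T} Z \<omega>)" for \<omega>
  define MY where "MY = PiM {1..n} (\<lambda>_. N) \<Otimes>\<^sub>M PiM {1..T} (\<lambda>_. B)"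
  define \<phi> where "\<phi> t w y = g w - \<eta> t *\<^sub>R F w (snd y t)" for t w and y :: "(nat \<Rightarrow> 'z) \<times> (nat \<Rightarrow> 'z multiset)"
  have tupZ': "tuple {1..n} Z' \<in> M \<rightarrow>\<^sub>M PiM {1..n} (\<lambda>_. N)"
    using indZ' unfolding tuple_def indep_vars_def by (intro measurable_restrict) auto
  have Y: "Y \<in> M \<rightarrow>\<^sub>M MY"
    unfolding Y_def MY_def using Z by (intro measurable_Pair tupZ') (auto simp: tuple_def intro!: measurable_restrict)
  interpret \<nu>: prob_space "distr M MY Y" by (rule prob_space_distr[OF Y])
  have Zt: "(\<lambda>y. snd y t) \<in> MY \<rightarrow>\<^sub>M B" if "t \<in> {1..T}" for t
    unfolding MY_def
    by (rule measurable_compose[OF measurable_snd measurable_component_singleton[OF that]])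
  have \<phi>: "case_prod (\<phi> t) \<in> borel_measurable (borel \<Otimes>\<^sub>M MY)" if t: "t \<in> {1..T}" for t
  proof -
    have "(\<lambda>x. (fst x, snd (snd x) t)) \<in> borel \<Otimes>\<^sub>M MY \<rightarrow>\<^sub>M borel \<Otimes>\<^sub>M B"
      by (intro measurable_Pair measurable_fst measurable_compose[OF measurable_snd Zt[OF t]])
    from measurable_compose[OF this F]
    have "(\<lambda>x. F (fst x) (snd (snd x) t)) \<in> borel_measurable (borel \<Otimes>\<^sub>M MY)" by simp
    moreover have "(\<lambda>x. g (fst x)) \<in> borel_measurable (borel \<Otimes>\<^sub>M MY)"
      by (rule measurable_compose[OF measurable_fst g])
    ultimately show ?thesis
      unfolding \<phi>_def case_prod_beta by (intro borel_measurable_diff borel_measurable_scaleR) auto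
  qed
  have fm: "(\<lambda>x. ennreal (f t x)) \<in> borel_measurable borel" if "t \<in> {1..T}" for t
    using f[OF that] by (simp add: distributed_def)
  \<comment> \<open>The ball contains \<open>0\<close>, so the density lies below the supremum of
    its translates and its total mass \<open>1\<close> is at most \<open>c t\<close>. This licenses
    \<open>ln_ennreal_prod\<close>.\<close>
  have c1: "1 \<le> c t" if t: "t \<in> {1..T}" for t
  proof -
    interpret D: prob_space "distr M lborel (\<xi> t)"
      using f[OF t] by (intro prob_space_distr) (simp add: distributed_def)
    have "1 = (\<integral>\<^sup>+x. ennreal (f t x) \<partial>lborel)"
      using D.emeasure_space_1 fm[OF t]
      by (simp add: distributed_distr_eq_density[OF f[OF t]] emeasure_density)
    also have "\<dots> \<le> c t"
      unfolding c_def
    proof (rule nn_integral_le_ball_plus_h_tail[where f="f t", OF fmax[OF t] fm[OF t]])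
      have "0 \<in> (lp_ball p (\<eta> t * L) :: (real ^ 'd) set)"
        using \<eta>[OF t] L by (intro zero_in_lp_ball) simp
      then show "ennreal (f t w) \<le> (SUP x\<in>lp_ball p (\<eta> t * L). ennreal (f t (w - x)))" for w
        by (intro SUP_upper2[of 0]) auto
    qed
    finally show ?thesis .
  qed
  have esssup_le: "(\<integral>\<^sup>+v. esssup (distr M MY Y) (\<lambda>y. ennreal (f t (v - \<phi> t w y))) \<partial>lborel) \<le> c t"
    if t: "t \<in> {1..T}" for t w
  proof -
    let ?k = "\<lambda>v. esssup (distr M MY Y) (\<lambda>y. ennreal (f t (v - \<phi> t w y)))"
    have \<phi>w: "\<phi> t w \<in> borel_measurable MY"
      using measurable_Pair2[OF \<phi>[OF t], of w] by simp
    have "(\<lambda>(v, y). ennreal (f t (v - \<phi> t w y))) \<in> borel_measurable (borel \<Otimes>\<^sub>M distr M MY Y)"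
      unfolding case_prod_beta
      by (rule measurable_compose[OF _ fm[OF t]])
         (intro borel_measurable_diff measurable_fst measurable_compose[OF measurable_snd], simp add: \<phi>w)
    then have k: "?k \<in> borel_measurable borel"
      by (rule borel_measurable_esssup[OF \<nu>.sigma_finite_measure_axioms])
    \<comment> \<open>Translation by \<open>g w\<close> removes the deterministic drift, leaving
      only the displacement by the direction \<open>F\<close>, which lies in the ball.\<close>
    have "(\<integral>\<^sup>+v. ?k v \<partial>lborel) = (\<integral>\<^sup>+v. ?k (g w + v) \<partial>lborel)"
      by (rule nn_integral_lborel_shift[symmetric, OF k])
    also have "\<dots> \<le> c t"
      unfolding c_def
    proof (rule nn_integral_le_ball_plus_h_tail[where f="f t", OF fmax[OF t]])
      show "(\<lambda>v. ?k (g w + v)) \<in> borel_measurable borel"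
        by (rule measurable_compose[OF _ k]) simp
      fix v
      show "?k (g w + v) \<le> (SUP x\<in>lp_ball p (\<eta> t * L). ennreal (f t (v - x)))"
      proof (rule esssup_I)
        show "(\<lambda>y. ennreal (f t (g w + v - \<phi> t w y))) \<in> borel_measurable (distr M MY Y)"
          by (rule measurable_compose[OF _ fm[OF t]])
             (intro borel_measurable_diff borel_measurable_const, simp add: \<phi>w)
        show "AE y in distr M MY Y. ennreal (f t (g w + v - \<phi> t w y))
            \<le> (SUP x\<in>lp_ball p (\<eta> t * L). ennreal (f t (v - x)))"
        proof (rule AE_I2)
          fix y assume "y \<in> space (distr M MY Y)"
          then have "lp_norm p (F w (snd y t)) \<le> L"
            using measurable_space[OF Zt[OF t], of y] by (intro FL) simp
          then have "\<eta> t *\<^sub>R F w (snd y t) \<in> lp_ball p (\<eta> t * L)"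
            using \<eta>[OF t] by (simp add: lp_ball_def lp_norm_scaleR[OF p])
          \<comment> \<open>After the translation the density is evaluated at
            \<open>v + \<eta> t *\<^sub>R F w (snd y t)\<close>, so the point subtracted from
            \<open>v\<close> is the negative of the step; the ball is symmetric.\<close>
          then have "- (\<eta> t *\<^sub>R F w (snd y t)) \<in> lp_ball p (\<eta> t * L)"
            by (simp only: lp_ball_uminus)
          then show "ennreal (f t (g w + v - \<phi> t w y))
              \<le> (SUP x\<in>lp_ball p (\<eta> t * L). ennreal (f t (v - x)))"
            by (rule SUP_upper2) (simp add: \<phi>_def)
        qed
      qed
    qed
    finally show ?thesis .
  qed
  have cfin: "c t \<noteq> \<infinity>" if "t \<in> {1..T}" for t
    using fin that by (simp add: c_def)
  have W': "W t \<omega> = \<phi> t (W (t - 1) \<omega>) (Y \<omega>) + \<xi> t \<omega>" if "t \<in> {1..T}" "\<omega> \<in> space M" for t \<omega>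
    using W[OF that] that(1) by (simp add: \<phi>_def Y_def tuple_def)
  have "\<exists>Q. finite_measure Q \<and> sets Q = sets (PiM {0..T} (\<lambda>_. borel :: (real ^ 'd) measure))
    \<and> emeasure Q (space Q) \<le> (\<Prod>t=1..T. c t)
    \<and> distr M (MY \<Otimes>\<^sub>M PiM {0..T} (\<lambda>_. borel)) (\<lambda>\<omega>. (Y \<omega>, tuple {0..T} W \<omega>)) \<le> distr M MY Y \<Otimes>\<^sub>M Q"
    using indW0 ind unfolding Y_def[symmetric] MY_def[symmetric]
    by (intro iterates_dominated[OF M Y W0 f _ ind\<xi> _ \<phi> W' cfin esssup_le])
  then obtain Q where Q: "finite_measure Q" "sets Q = sets (PiM {0..T} (\<lambda>_. borel :: (real ^ 'd) measure))"
    "emeasure Q (space Q) \<le> (\<Prod>t=1..T. c t)"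
    "distr M (MY \<Otimes>\<^sub>M PiM {0..T} (\<lambda>_. borel)) (\<lambda>\<omega>. (Y \<omega>, tuple {0..T} W \<omega>)) \<le> distr M MY Y \<Otimes>\<^sub>M Q"
    by (elim exE conjE)
  interpret Q: finite_measure Q by (rule Q(1))
  have \<xi>: "\<xi> t \<in> borel_measurable M" if "t \<in> {1..T}" for t
    using f[OF that] by (simp add: distributed_def)
  have Wm: "W t \<in> borel_measurable M" if "t \<le> T" for t
    using that
  proof (induction t)
    case (Suc t)
    then have t: "Suc t \<in> {1..T}" "W t \<in> borel_measurable M" by auto
    have "(\<lambda>\<omega>. \<phi> (Suc t) (W t \<omega>) (Y \<omega>) + \<xi> (Suc t) \<omega>) \<in> borel_measurable M"
      using measurable_compose[OF measurable_Pair[OF t(2) Y] \<phi>[OF t(1)]] \<xi>[OF t(1)] by simp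
    then show ?case
      by (rule measurable_cong[THEN iffD2, rotated]) (use W'[OF t(1)] in simp)
  qed (rule W0)
  have tupW: "tuple {0..T} W \<in> M \<rightarrow>\<^sub>M PiM {0..T} (\<lambda>_. borel)"
    unfolding tuple_def using Wm by (intro measurable_restrict) auto
  \<comment> \<open>The dominated law includes \<open>W 0\<close> and the mini-batches. The
    restriction discards \<open>W 0\<close> before \<open>out\<close> is applied, and
    \<open>fst\<close> below discards the mini-batches.\<close>
  let ?g = "\<lambda>x. out (restrict x {1..T})"
  have g': "?g \<in> PiM {0..T} (\<lambda>_. borel) \<rightarrow>\<^sub>M Out"
    by (rule measurable_compose[OF measurable_restrict_subset out]) auto
  then have gQ: "?g \<in> Q \<rightarrow>\<^sub>M Out"
    by (simp cong: measurable_cong_sets add: Q(2))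
  have gW: "?g (tuple {0..T} W \<omega>) = out (tuple {1..T} W \<omega>)" for \<omega>
    by (auto simp: tuple_def intro!: arg_cong[where f=out])
  have fstY: "fst (Y \<omega>) = tuple {1..n} Z' \<omega>" for \<omega> by (simp add: Y_def)
  have "distr M (PiM {1..n} (\<lambda>_. N) \<Otimes>\<^sub>M Out) (\<lambda>\<omega>. (fst (Y \<omega>), ?g (tuple {0..T} W \<omega>)))
      \<le> distr M (PiM {1..n} (\<lambda>_. N)) (\<lambda>\<omega>. fst (Y \<omega>)) \<Otimes>\<^sub>M distr Q Out ?g"
    by (rule distr_pair_dominated_map[OF Y tupW _ g' Q(1,2,4)]) (simp add: MY_def)
  then have dom: "distr M (PiM {1..n} (\<lambda>_. N) \<Otimes>\<^sub>M Out) (\<lambda>\<omega>. (tuple {1..n} Z' \<omega>, out (tuple {1..T} W \<omega>)))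
      \<le> distr M (PiM {1..n} (\<lambda>_. N)) (tuple {1..n} Z') \<Otimes>\<^sub>M distr Q Out ?g"
    unfolding gW fstY .
  have outW: "(\<lambda>\<omega>. out (tuple {1..T} W \<omega>)) \<in> M \<rightarrow>\<^sub>M Out"
    using measurable_compose[OF tupW g'] unfolding gW .
  have mass: "emeasure (distr Q Out ?g) (space (distr Q Out ?g)) \<le> (\<Prod>t=1..T. c t)"
  proof -
    have "?g -` space Out \<inter> space Q = space Q" using measurable_space[OF gQ] by auto
    then show ?thesis using Q(3) by (simp only: space_distr emeasure_distr[OF gQ sets.top])
  qed
  have "(\<Prod>t=1..T. c t) \<noteq> \<infinity>"
    using cfin by (simp add: ennreal_prod_eq_top)
  then have "maximal_leakage M (PiM {1..n} (\<lambda>_. N)) (tuple {1..n} Z') Out (\<lambda>\<omega>. out (tuple {1..T} W \<omega>))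
      \<le> ln_ennreal (\<Prod>t=1..T. c t)"
    by (intro maximal_leakage_le[OF M tupZ' outW Q.finite_measure_distr[OF gQ] sets_distr _ mass dom])
  also have "\<dots> = (\<Sum>t=1..T. ln_ennreal (c t))"
    using c1 cfin by (intro ln_ennreal_prod) auto
  finally show ?thesis by (simp only: c_def)
next
  case False
  then have "\<infinity> \<in> (\<lambda>t. ln_ennreal (ennreal (f t 0) * lp_ball_vol TYPE('d) p (\<eta> t * L)
      + h_tail p (f t) (\<eta> t * L))) ` {1..T}"
    by (auto simp: ln_ennreal_def image_iff)
  \<comment> \<open>In \<open>ereal\<close> a single summand \<open>\<infinity>\<close> makes a
    finite sum infinite, whatever the other summands are, so the bound is trivial here.\<close>
  then have "(\<Sum>t = 1..T. ln_ennreal (ennreal (f t 0) * lp_ball_vol TYPE('d) p (\<eta> t * L)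
      + h_tail p (f t) (\<eta> t * L))) = \<infinity>"
    by (subst sum_Pinfty) force
  then show ?thesis by simp
qed

end
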